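(* Let $G$ be any graph and let $C_1,C_2\subseteq G$ be two different circles. Then there exist a Cantor set $B$, a minimal continuous map $f:B\to B$, a connected graph $\Gamma$, a continuous map $F:B\times\Gamma\to B\times\Gamma$ with $\mathrm{pr}_1\circ F=f\circ\mathrm{pr}_1$, a minimal set $M$ of $F$ and a point $b\in B$ such that $M_z=M\cap(\{z\}\times\Gamma)$ is a circle for each $z\ne b$, and $M_b$ is a union of two circles homeomorphic to $C_1\cup C_2$. In particular, there exist such systems for which $M_b$ is a union of two disjoint circles.
   Context: A graph is a nonempty compact metric space that is a union of finitely many arcs, any two of which are disjoint or meet only in one or both of their end-points. A circle is a simple closed curve. A continuous selfmap of a compact metric space is minimal if it has no proper nonempty closed invariant subset; a minimal set of $F$ is a nonempty closed set $M$ with $F(M)\subseteq M$ on which $F$ is minimal. *)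

theory Defs
  imports "HOL-Analysis.Analysis"
begin

definition is_graph :: "'a::metric_space set \<Rightarrow> bool" where
  "is_graph G \<longleftrightarrow>
     (\<exists>\<G> :: (real \<Rightarrow> 'a) set. finite \<G> \<and> \<G> \<noteq> {} \<and> (\<forall>g\<in>\<G>. arc g) \<and>
        G = \<Union>(path_image ` \<G>) \<and>
        (\<forall>g\<in>\<G>. \<forall>g'\<in>\<G>. path_image g \<noteq> path_image g' \<longrightarrow>
            path_image g \<inter> path_image g' \<subseteq>
              {pathstart g, pathfinish g} \<inter> {pathstart g', pathfinish g'}))"

definition circle :: "'a::topological_space set \<Rightarrow> bool" where
  "circle C \<longleftrightarrow> C homeomorphic (sphere (0::complex) 1)"

definition cantor_ternary :: "real set" where
  "cantor_ternary = {x. \<exists>a::nat \<Rightarrow> bool. x = (\<Sum>n. (if a n then 2 else 0) / 3 ^ Suc n)}"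

definition cantor_set :: "'a::topological_space set \<Rightarrow> bool" where
  "cantor_set B \<longleftrightarrow> B homeomorphic cantor_ternary"

definition minimal_map :: "'a::metric_space set \<Rightarrow> ('a \<Rightarrow> 'a) \<Rightarrow> bool" where
  "minimal_map X f \<longleftrightarrow> continuous_on X f \<and> f ` X \<subseteq> X \<and>
     (\<forall>K. K \<subseteq> X \<and> closedin (top_of_set X) K \<and> K \<noteq> {} \<and> f ` K \<subseteq> K \<longrightarrow> K = X)"

definition minimal_set :: "('a::metric_space \<Rightarrow> 'a) \<Rightarrow> 'a set \<Rightarrow> bool" where
  "minimal_set F M \<longleftrightarrow> M \<noteq> {} \<and> closed M \<and> F ` M \<subseteq> M \<and>
     (\<forall>K. K \<subseteq> M \<and> closedin (top_of_set M) K \<and> K \<noteq> {} \<and> F ` K \<subseteq> K \<longrightarrow> K = M)"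

text \<open>The skew-product system required by the theorem, with the fibre over b
  satisfying a given property P.  The Cantor set lives in the reals and the graph
  \<Gamma> in real^3 (every Cantor set embeds in R, every graph in R^3).\<close>
definition skew_system ::
  "real set \<Rightarrow> (real \<Rightarrow> real) \<Rightarrow> (real^3) set \<Rightarrow> (real \<times> (real^3) \<Rightarrow> real \<times> (real^3))
    \<Rightarrow> (real \<times> (real^3)) set \<Rightarrow> real \<Rightarrow> bool" where
  "skew_system B f \<Gamma> F M b \<longleftrightarrow>
     cantor_set B \<and> minimal_map B f \<and> is_graph \<Gamma> \<and> connected \<Gamma> \<and>
     continuous_on (B \<times> \<Gamma>) F \<and> F ` (B \<times> \<Gamma>) \<subseteq> B \<times> \<Gamma> \<and>
     (\<forall>p\<in>B \<times> \<Gamma>. fst (F p) = f (fst p)) \<and>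
     M \<subseteq> B \<times> \<Gamma> \<and> minimal_set F M \<and> b \<in> B \<and>
     (\<forall>z\<in>B. z \<noteq> b \<longrightarrow> circle (M \<inter> ({z} \<times> \<Gamma>)))"

end

theory Submission
  imports Defs "HOL-Complex_Analysis.Contour_Integration"
begin

text \<open>Suppose that a connected graph \<open>\<Gamma>\<close> carries a continuous map \<open>h\<close> onto the unit circle with
  continuous sections \<open>s\<^sub>0, \<dots>, s\<^sub>N\<^sub>-\<^sub>1\<close>, and that \<open>f\<close> is a minimal map of a Cantor set \<open>B\<close>,
  injective except that one point \<open>b\<close> has \<open>N\<close> preimages, which are told apart by a locally
  constant index. For an irrational rotation \<open>\<rho>\<close> put \<open>F (z, x) = (f z, s\<^sub>i (\<rho> h(x)))\<close> with \<open>i\<close> the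
  index of \<open>z\<close>, and let \<open>M\<close> be the image of \<open>F\<close>. The fibre of \<open>M\<close> over \<open>b\<close> is the union of the
  images of all sections, and every other fibre is the image of one section, hence a circle. A
  closed invariant subset \<open>K\<close> of \<open>M\<close> projects onto \<open>B \<times> S\<^sup>1\<close> because \<open>f \<times> \<rho>\<close> is minimal, and
  \<open>F(K)\<close> depends only on this projection, so \<open>K = M\<close>.

  It remains to write the union of two circles in a graph as a union of sections. If they meet,
  the second circle consists of a part of the first one and of finitely many arcs with end-points
  on the first one. Map the first circle homeomorphically onto \<open>S\<^sup>1\<close> and each such arc
  homeomorphically onto one of the arcs of \<open>S\<^sup>1\<close> between the images of its end-points; replacing
  the latter arc by the former gives a section. Disjoint circles are two parallel sections, joined
  by a segment.\<close>

section \<open>The Cantor set\<close>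

definition ternary_value :: "(nat \<Rightarrow> bool) \<Rightarrow> real" where
  "ternary_value a = (\<Sum>n. (if a n then 2 else 0) / 3 ^ Suc n)"

lemma cantor_ternary_eq_range: "cantor_ternary = range ternary_value"
  by (auto simp: cantor_ternary_def ternary_value_def)

lemma sums_two_thirds: "(\<lambda>n. 2 / 3 ^ Suc n :: real) sums 1"
proof -
  have "(\<lambda>n. (2/3) * (1/3) ^ n :: real) sums ((2/3) * (1 / (1 - 1/3)))"
    by (intro sums_mult geometric_sums) auto
  then show ?thesis by (simp add: power_one_over field_simps)
qed

lemma summable_ternary: "summable (\<lambda>n. (if a n then 2 else 0) / 3 ^ Suc n :: real)"
  by (rule summable_comparison_test'[OF sums_summable[OF sums_two_thirds], of 0]) auto

lemma ternary_value_bounds: "0 \<le> ternary_value a" "ternary_value a \<le> 1"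
proof -
  show "0 \<le> ternary_value a"
    unfolding ternary_value_def by (intro suminf_nonneg summable_ternary) auto
  have "ternary_value a \<le> (\<Sum>n. 2 / 3 ^ Suc n)"
    unfolding ternary_value_def
    by (intro suminf_le summable_ternary sums_summable[OF sums_two_thirds])
       (auto simp: divide_right_mono)
  then show "ternary_value a \<le> 1" using sums_unique[OF sums_two_thirds] by simp
qed

lemma ternary_value_rec:
  "ternary_value a = (if a 0 then 2 else 0) / 3 + ternary_value (\<lambda>n. a (Suc n)) / 3"
proof -
  have "ternary_value a = (if a 0 then 2 else 0) / 3
      + (\<Sum>n. (if a (Suc n) then 2 else 0) / 3 ^ Suc (Suc n))"
    unfolding ternary_value_def using suminf_split_head[OF summable_ternary[of a]] by simp
  also have "(\<Sum>n. (if a (Suc n) then 2 else 0) / 3 ^ Suc (Suc n) :: real)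
      = ternary_value (\<lambda>n. a (Suc n)) / 3"
    unfolding ternary_value_def
    by (subst suminf_divide[OF summable_ternary, symmetric]) (simp add: field_simps)
  finally show ?thesis .
qed

lemma ternary_value_eq_head:
  assumes "ternary_value a = ternary_value b"
  shows "a 0 = b 0" "ternary_value (\<lambda>n. a (Suc n)) = ternary_value (\<lambda>n. b (Suc n))"
proof -
  note bounds = ternary_value_bounds[of "\<lambda>n. a (Suc n)"] ternary_value_bounds[of "\<lambda>n. b (Suc n)"]
  show "a 0 = b 0"
    using assms bounds ternary_value_rec[of a] ternary_value_rec[of b]
    by (cases "a 0"; cases "b 0") auto
  then show "ternary_value (\<lambda>n. a (Suc n)) = ternary_value (\<lambda>n. b (Suc n))"
    using assms ternary_value_rec[of a] ternary_value_rec[of b] by auto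
qed

lemma inj_ternary_value: "inj ternary_value"
proof
  have "a n = b n" if "ternary_value a = ternary_value b" for a b n
    using that
  proof (induction n arbitrary: a b)
    case (Suc n)
    then show ?case using ternary_value_eq_head(2) by blast
  qed (use ternary_value_eq_head(1) in blast)
  then show "a = b" if "ternary_value a = ternary_value b" for a b using that by blast
qed

lemma continuous_on_ternary_value:
  fixes bit :: "'a::topological_space \<Rightarrow> nat \<Rightarrow> bool"
  assumes "\<And>n. continuous_on X (\<lambda>x. if bit x n then 2 else 0 :: real)"
  shows "continuous_on X (\<lambda>x. ternary_value (bit x))"
proof -
  have "uniform_limit X (\<lambda>n x. \<Sum>i<n. (if bit x i then 2 else 0) / 3 ^ Suc i)
      (\<lambda>x. ternary_value (bit x)) sequentially"
    unfolding ternary_value_def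
    by (rule Weierstrass_m_test[OF _ sums_summable[OF sums_two_thirds]]) auto
  then show ?thesis
    by (rule uniform_limit_theorem[rotated])
       (auto intro!: always_eventually continuous_intros assms simp del: power_Suc)
qed

text \<open>Cells are addressed by lists of bits, the latest bit first.\<close>

primrec branch :: "(nat \<Rightarrow> bool) \<Rightarrow> nat \<Rightarrow> bool list" where
  "branch a 0 = []"
| "branch a (Suc n) = a n # branch a n"

lemma length_branch [simp]: "length (branch a n) = n"
  by (induction n) auto

locale cantor_scheme =
  fixes X :: "'a::topological_space set" and A :: "bool list \<Rightarrow> 'a set"
  assumes compact_X: "compact X"
    and root: "A [] = X"
    and split: "A (True # w) \<union> A (False # w) = A w"
    and disjoint: "A (True # w) \<inter> A (False # w) = {}"
    and closedin_cell: "closedin (top_of_set X) (A w)"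
    and nonempty_cell: "A w \<noteq> {}"
    and separating: "\<lbrakk>x \<in> X; y \<in> X; \<And>w. x \<in> A w \<longleftrightarrow> y \<in> A w\<rbrakk> \<Longrightarrow> x = y"
begin

lemma child_subset: "A (c # w) \<subseteq> A w"
  using split by (cases c) auto

lemma cell_subset: "A w \<subseteq> X"
  using closedin_imp_subset[OF closedin_cell] .

lemma cell_unique: "length v = length w \<Longrightarrow> x \<in> A v \<Longrightarrow> x \<in> A w \<Longrightarrow> v = w"
proof (induction v w rule: list_induct2)
  case (Cons c v d w)
  then have "v = w" using child_subset by blast
  moreover have "c = d" using Cons.prems \<open>v = w\<close> disjoint[of w] by (cases c; cases d) auto
  ultimately show ?case by simp
qed simp

definition digit :: "'a \<Rightarrow> nat \<Rightarrow> bool" where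
  "digit x n \<longleftrightarrow> (\<exists>w. length w = n \<and> x \<in> A (True # w))"

lemma digit_iff: "x \<in> A w \<Longrightarrow> digit x (length w) \<longleftrightarrow> x \<in> A (True # w)"
  unfolding digit_def using child_subset cell_unique by blast

lemma mem_branch_digit: "x \<in> X \<Longrightarrow> x \<in> A (branch (digit x) n)"
proof (induction n)
  case (Suc n)
  then show ?case using digit_iff[of x "branch (digit x) n"] split[of "branch (digit x) n"] by auto
qed (simp add: root)

lemma digit_eqI: "(\<And>n. x \<in> A (branch a n)) \<Longrightarrow> digit x = a"
proof
  fix n assume "\<And>n. x \<in> A (branch a n)"
  then have "x \<in> A (branch a n)" "x \<in> A (a n # branch a n)" by (metis branch.simps(2))+
  then show "digit x n = a n"
    using digit_iff[of x "branch a n"] disjoint[of "branch a n"] by (cases "a n") auto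
qed

lemma inj_on_digit: "inj_on digit X"
proof (rule inj_onI, rule separating)
  fix x y w assume "x \<in> X" "y \<in> X" "digit x = digit y"
  then show "x \<in> A w \<longleftrightarrow> y \<in> A w"
    using mem_branch_digit cell_unique length_branch by metis
qed

lemma image_digit: "digit ` X = UNIV"
proof -
  have "a \<in> digit ` X" for a
  proof -
    have "(\<Inter>n. A (branch a n)) \<noteq> {}"
    proof (rule compact_space_imp_nest)
      show "compact_space (top_of_set X)" using compact_X by (simp add: compact_space_subtopology)
      show "decseq (\<lambda>n. A (branch a n))" by (rule decseq_SucI) (simp add: child_subset)
    qed (simp_all add: closedin_cell nonempty_cell)
    then obtain x where x: "\<And>n. x \<in> A (branch a n)" by blast
    then have "digit x = a" by (rule digit_eqI)
    moreover have "x \<in> X" using x cell_subset by blast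
    ultimately show ?thesis by blast
  qed
  then show ?thesis by blast
qed

lemma continuous_on_digit: "continuous_on X (\<lambda>x. if digit x n then 2 else 0 :: real)"
proof -
  let ?level = "{w :: bool list. length w = n}"
  define P where "P c = (\<Union>w\<in>?level. A (c # w))" for c
  have "finite ?level" using finite_lists_length_eq[of "UNIV :: bool set" n] by simp
  then have closed_P: "closedin (top_of_set X) (P c)" for c
    unfolding P_def by (intro closedin_Union) (auto simp: closedin_cell)
  have X_eq: "X = P True \<union> P False"
  proof (intro antisym subsetI)
    fix x assume "x \<in> X"
    then have "x \<in> A (branch (digit x) n)" by (rule mem_branch_digit)
    then show "x \<in> P True \<union> P False"
      unfolding P_def using split[of "branch (digit x) n"] length_branch by blast
  qed (use cell_subset in \<open>auto simp: P_def\<close>)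
  have digit_P: "digit x n \<longleftrightarrow> c" if x: "x \<in> P c" for x c
  proof -
    obtain w where "length w = n" "x \<in> A (c # w)" using x by (auto simp: P_def)
    then show ?thesis using digit_iff[of x w] child_subset disjoint[of w] by (cases c) auto
  qed
  show ?thesis
    using continuous_on_cases_local[of "P True" "P False" "\<lambda>_. 2" "\<lambda>_. 0 :: real" "\<lambda>x. digit x n"]
      closed_P digit_P unfolding X_eq[symmetric] by auto
qed

lemma cantor_set_space: "cantor_set X"
  unfolding cantor_set_def
proof (rule homeomorphic_compact[OF compact_X])
  show "continuous_on X (\<lambda>x. ternary_value (digit x))"
    by (intro continuous_on_ternary_value continuous_on_digit)
  show "(\<lambda>x. ternary_value (digit x)) ` X = cantor_ternary"
    unfolding cantor_ternary_eq_range image_digit[symmetric] by (simp add: image_image)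
  show "inj_on (\<lambda>x. ternary_value (digit x)) X"
    using comp_inj_on[OF inj_on_digit inj_on_subset[OF inj_ternary_value]] by (simp add: comp_def)
qed

end

definition splits :: "'a set \<Rightarrow> 'a set \<Rightarrow> bool" where
  "splits T S \<longleftrightarrow> S \<inter> T \<noteq> {} \<and> S - T \<noteq> {}"

text \<open>At depth \<open>n\<close> a cell is divided by \<open>U n\<close> whenever this is possible, which makes the scheme
  separate all points that the family \<open>U\<close> separates.\<close>

definition divider :: "(nat \<Rightarrow> 'a set) \<Rightarrow> nat \<Rightarrow> 'a set \<Rightarrow> 'a set" where
  "divider U n S = (if splits (U n) S then U n else U (SOME k. splits (U k) S))"

primrec division :: "(nat \<Rightarrow> 'a set) \<Rightarrow> 'a set \<Rightarrow> bool list \<Rightarrow> 'a set" where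
  "division U X [] = X"
| "division U X (c # w) =
     (let S = division U X w; T = divider U (length w) S in if c then S \<inter> T else S - T)"

lemma splits_divider: "splits (U k) S \<Longrightarrow> splits (divider U n S) S"
  unfolding divider_def by (auto intro: someI)

lemma mem_division_of_length: "x \<in> X \<Longrightarrow> \<exists>w. length w = n \<and> x \<in> division U X w"
proof (induction n)
  case (Suc n)
  then obtain w where "length w = n" "x \<in> division U X w" by blast
  then show ?case
    by (intro exI[of _ "(x \<in> divider U n (division U X w)) # w"]) (auto simp: Let_def)
qed simp

lemma division_separates:
  assumes "x \<in> X" "y \<in> X" "x \<in> U n" "y \<notin> U n"
  shows "\<exists>w. x \<in> division U X w \<longleftrightarrow> y \<notin> division U X w"
proof -
  obtain w where w: "length w = n" "x \<in> division U X w"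
    using mem_division_of_length[OF assms(1)] by metis
  show ?thesis
  proof (cases "y \<in> division U X w")
    case True
    then have "splits (U n) (division U X w)" using assms w by (auto simp: splits_def)
    then have "divider U n (division U X w) = U n" by (simp add: divider_def)
    then show ?thesis using assms w by (intro exI[of _ "True # w"]) (auto simp: Let_def)
  qed (use w in blast)
qed

lemma clopen_division:
  fixes X :: "'a::topological_space set"
  assumes X: "X \<noteq> {}"
    and U_open: "\<And>n. openin (top_of_set X) (X \<inter> U n)"
    and U_closed: "\<And>n. closedin (top_of_set X) (X \<inter> U n)"
    and splittable: "\<And>S. \<lbrakk>openin (top_of_set X) S; S \<noteq> {}\<rbrakk> \<Longrightarrow> \<exists>n. splits (U n) S"
  shows "openin (top_of_set X) (division U X w) \<and> closedin (top_of_set X) (division U X w) \<and>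
    division U X w \<noteq> {}"
proof (induction w)
  case (Cons c w)
  let ?S = "division U X w"
  define T where "T = divider U (length w) ?S"
  obtain k where T: "T = U k" unfolding T_def divider_def by metis
  have "splits T ?S" using splittable splits_divider Cons.IH unfolding T_def by blast
  then have "?S \<inter> T \<noteq> {}" "?S - T \<noteq> {}" by (auto simp: splits_def)
  moreover have "?S \<subseteq> X" using Cons.IH openin_imp_subset by blast
  then have "?S \<inter> T = ?S \<inter> (X \<inter> U k)" "?S - T = ?S - X \<inter> U k" using T by auto
  moreover have "division U X (c # w) = (if c then ?S \<inter> T else ?S - T)"
    by (simp add: T_def Let_def)
  ultimately show ?case
    using Cons.IH U_open[of k] U_closed[of k]
    by (auto intro: openin_Int closedin_Int openin_diff closedin_diff)
qed (simp add: X)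

lemma clopen_separated_imp_cantor_set:
  fixes X :: "'a::topological_space set" and U :: "nat \<Rightarrow> 'a set"
  assumes X: "compact X" "X \<noteq> {}"
    and U_open: "\<And>n. openin (top_of_set X) (X \<inter> U n)"
    and U_closed: "\<And>n. closedin (top_of_set X) (X \<inter> U n)"
    and separating: "\<And>x y. \<lbrakk>x \<in> X; y \<in> X; x \<noteq> y\<rbrakk> \<Longrightarrow> \<exists>n. x \<in> U n \<longleftrightarrow> y \<notin> U n"
    and perfect: "\<And>x S. \<lbrakk>x \<in> S; openin (top_of_set X) S\<rbrakk> \<Longrightarrow> \<exists>y\<in>S. y \<noteq> x"
  shows "cantor_set X"
proof -
  have splittable: "\<exists>n. splits (U n) S" if S: "openin (top_of_set X) S" "S \<noteq> {}" for S
  proof -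
    obtain x where x: "x \<in> S" using S(2) by blast
    obtain y where y: "y \<in> S" "y \<noteq> x" using perfect[OF x S(1)] by auto
    have "S \<subseteq> X" using S(1) openin_imp_subset by blast
    then obtain n where "x \<in> U n \<longleftrightarrow> y \<notin> U n" using separating x y by (metis subsetD)
    then show ?thesis using x y by (auto simp: splits_def)
  qed
  interpret cantor_scheme X "division U X"
  proof
    show "closedin (top_of_set X) (division U X w)" "division U X w \<noteq> {}" for w
      using clopen_division[OF X(2) U_open U_closed splittable] by blast+
    show "x = y" if "x \<in> X" "y \<in> X" "\<And>w. x \<in> division U X w \<longleftrightarrow> y \<in> division U X w" for x y
      using that separating division_separates by metis
  qed (use X(1) in \<open>auto simp: Let_def\<close>)
  show ?thesis by (rule cantor_set_space)
qed

section \<open>A minimal map of the Cantor set with one branching point\<close>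

lemma continuous_on_finite_coordinates:
  fixes g :: "(nat \<Rightarrow> 'a::discrete_topology) \<Rightarrow> 'b::topological_space"
  assumes "\<And>x y. (\<And>i. i \<le> n \<Longrightarrow> x i = y i) \<Longrightarrow> g x = g y"
  shows "continuous_on S g"
  unfolding continuous_on_def
proof
  fix x assume "x \<in> S"
  let ?cylinder = "{y. \<forall>i\<in>{..n}. y i \<in> {x i}}"
  have "open ?cylinder" by (rule product_topology_basis') (auto simp: open_discrete)
  moreover have "\<forall>y\<in>?cylinder. g y = g x" by (auto intro: assms)
  ultimately have "\<forall>\<^sub>F y in at x within S. g y = g x"
    unfolding eventually_at_topological by (intro exI[of _ ?cylinder]) blast
  then show "(g \<longlongrightarrow> g x) (at x within S)" by (rule tendsto_eventually)
qed

lemma open_contains_cylinder: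
  fixes W :: "(nat \<Rightarrow> 'b::topological_space) set"
  assumes "open W" "x \<in> W"
  obtains n where "\<And>y. (\<And>i. i < n \<Longrightarrow> y i = x i) \<Longrightarrow> y \<in> W"
proof -
  have "openin (product_topology (\<lambda>_. euclidean) UNIV) W"
    using assms(1) by (simp add: euclidean_product_topology)
  then obtain U where U: "finite {i. U i \<noteq> UNIV}" "x \<in> Pi\<^sub>E UNIV U" "Pi\<^sub>E UNIV U \<subseteq> W"
    using assms(2) unfolding openin_product_topology_alt by force
  obtain n where n: "\<forall>i\<in>{i. U i \<noteq> UNIV}. i < n"
    using U(1) unfolding finite_nat_set_iff_bounded ..
  have "y \<in> W" if y: "\<And>i. i < n \<Longrightarrow> y i = x i" for y
  proof -
    have "y i \<in> U i" for i
      using y[of i] n U(2) by (cases "U i = UNIV") auto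
    then show ?thesis using U(3) by (auto simp: PiE_iff)
  qed
  then show ?thesis using that by blast
qed

text \<open>Paths in the Bratteli diagram with \<open>N\<close> vertices at each level in which the edges ending at
  vertex \<open>j\<close> start, in this order, at \<open>0, \<dots>, N-1, j\<close>. A digit \<open>c < N\<close> stands for the \<open>c\<close>-th edge,
  which starts at vertex \<open>c\<close>, and a digit \<open>N + j\<close> for the last edge, from \<open>j\<close> to \<open>j\<close>. The
  successor (Vershik) map has one minimal path, and sends all \<open>N\<close> maximal paths \<open>N + j, N + j, \<dots>\<close>
  to it.\<close>

definition paths :: "nat \<Rightarrow> (nat \<Rightarrow> nat) set" where
  "paths N = {p. \<forall>n. p n < 2 * N \<and> (N \<le> p n \<longrightarrow> p (Suc n) mod N = p n mod N)}"

definition successor :: "nat \<Rightarrow> (nat \<Rightarrow> nat) \<Rightarrow> nat \<Rightarrow> nat" where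
  "successor N p k =
     (if \<forall>i<k. N \<le> p i
      then if N \<le> p k then 0 else if Suc (p k) < N then Suc (p k) else N + p (Suc k) mod N
      else p k)"

lemma paths_less: "p \<in> paths N \<Longrightarrow> p n < 2 * N"
  and paths_mod: "p \<in> paths N \<Longrightarrow> N \<le> p n \<Longrightarrow> p (Suc n) mod N = p n mod N"
  by (auto simp: paths_def)

lemma paths_last_edge: "p \<in> paths N \<Longrightarrow> N \<le> p n \<Longrightarrow> p n = N + p (Suc n) mod N"
  using paths_less[of p N n] paths_mod[of p N n] by (simp add: le_mod_geq)

lemma paths_eq_below:
  assumes "p \<in> paths N" "q \<in> paths N" "\<And>i. i < n \<Longrightarrow> min (p i) N = min (q i) N"
    and "p n mod N = q n mod N" "i < n"
  shows "p i = q i"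
  using assms(3-)
proof (induction n)
  case (Suc n)
  have "p n = q n"
  proof (cases "N \<le> p n")
    case True
    then have "N \<le> q n" using Suc.prems(1)[of n] by linarith
    then show ?thesis
      using paths_last_edge[OF assms(1) True] paths_last_edge[OF assms(2)] Suc.prems(2) by metis
  qed (use Suc.prems(1)[of n] in linarith)
  then show ?case using Suc by (cases "i = n") auto
qed simp

lemma zero_in_paths: "0 < N \<Longrightarrow> (\<lambda>_. 0) \<in> paths N"
  by (simp add: paths_def)

lemma const_in_paths: "j < N \<Longrightarrow> (\<lambda>_. N + j) \<in> paths N"
  by (simp add: paths_def)

lemma successor_in_paths:
  assumes "p \<in> paths N" "0 < N"
  shows "successor N p \<in> paths N"
  unfolding paths_def
proof (intro CollectI allI conjI impI)
  fix n
  show "successor N p n < 2 * N"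
    using paths_less[OF assms(1)] assms(2) by (auto simp: successor_def mult_2)
  assume "N \<le> successor N p n"
  then show "successor N p (Suc n) mod N = successor N p n mod N"
    using assms(2) paths_mod[OF assms(1), of n]
    by (auto simp: successor_def less_Suc_eq split: if_splits)
qed

lemma continuous_on_successor: "continuous_on S (successor N)"
proof (rule continuous_on_coordinatewise_then_product)
  fix k
  show "continuous_on S (\<lambda>p. successor N p k)"
  proof (rule continuous_on_finite_coordinates[of "Suc k"])
    fix x y :: "nat \<Rightarrow> nat" assume eq: "\<And>i. i \<le> Suc k \<Longrightarrow> x i = y i"
    then have "(\<forall>i<k. N \<le> x i) \<longleftrightarrow> (\<forall>i<k. N \<le> y i)" by simp
    then show "successor N x k = successor N y k"
      unfolding successor_def using eq[of k] eq[of "Suc k"] by (simp cong: if_cong)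
  qed
qed

lemma compact_paths: "compact (paths N)"
proof -
  let ?Q = "Pi\<^sub>E UNIV (\<lambda>_::nat. {..<2 * N})"
  have "compactin (product_topology (\<lambda>_::nat. euclidean) UNIV) ?Q"
    unfolding compactin_PiE by (simp add: finite_imp_compact)
  then have compact_Q: "compact ?Q" by (simp add: euclidean_product_topology)
  let ?linked = "\<lambda>n (p::nat \<Rightarrow> nat). N \<le> p n \<longrightarrow> p (Suc n) mod N = p n mod N"
  have "closed {p. ?linked n p}" for n
  proof -
    have "continuous_on UNIV (?linked n)"
      by (rule continuous_on_finite_coordinates[of "Suc n"]) simp
    then have "closed (?linked n -` {True})"
      by (intro closed_vimage) (auto simp: closed_def open_discrete)
    then show ?thesis by (simp add: vimage_def)
  qed
  then have "compact (?Q \<inter> (\<Inter>n. {p. ?linked n p}))"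
    by (intro compact_Int_closed[OF compact_Q]) blast
  moreover have "?Q \<inter> (\<Inter>n. {p. ?linked n p}) = paths N"
    by (auto simp: paths_def PiE_iff)
  ultimately show ?thesis by simp
qed

lemma paths_not_isolated:
  assumes p: "p \<in> paths N" and "0 < N"
  obtains q where "q \<in> paths N" "q \<noteq> p" "\<And>i. i < n \<Longrightarrow> q i = p i"
proof -
  define q where "q c i = (if i < n then p i else if i = n then p n mod N else c)" for c i
  have q_paths: "q c \<in> paths N" if "c = 0 \<or> c = N" for c
    unfolding paths_def
  proof (intro CollectI allI conjI impI)
    fix i
    have "p n mod N < N" using \<open>0 < N\<close> by simp
    then have "p n mod N < 2 * N" by linarith
    then show "q c i < 2 * N" using paths_less[OF p, of i] \<open>0 < N\<close> that by (auto simp: q_def)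
    assume "N \<le> q c i"
    then consider "i < n" "N \<le> p i" | "i > n"
      using \<open>p n mod N < N\<close> by (auto simp: q_def split: if_splits)
    then show "q c (Suc i) mod N = q c i mod N"
    proof cases
      case 1
      then have "q c (Suc i) mod N = p (Suc i) mod N" by (cases "Suc i = n") (auto simp: q_def)
      then show ?thesis using 1 paths_mod[OF p, of i] by (simp add: q_def)
    qed (use that in \<open>auto simp: q_def\<close>)
  qed
  have "q 0 (Suc n) \<noteq> q N (Suc n)" using \<open>0 < N\<close> by (simp add: q_def)
  then have "q 0 \<noteq> p \<or> q N \<noteq> p" by metis
  moreover have "q c i = p i" if "i < n" for c i using that by (simp add: q_def)
  ultimately show ?thesis using that q_paths by metis
qed

lemma cantor_set_paths:
  assumes "0 < N"
  shows "cantor_set (paths N)"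
proof (rule clopen_separated_imp_cantor_set)
  define U where "U m = {p :: nat \<Rightarrow> nat. p (fst (prod_decode m)) = snd (prod_decode m)}" for m
  have U_prod_encode: "U (prod_encode (i, c)) = {p. p i = c}" for i c
    by (simp add: U_def)
  fix m
  have "U m = (\<lambda>p. p (fst (prod_decode m))) -` {snd (prod_decode m)}" by (auto simp: U_def)
  then have "open (U m)" "closed (U m)"
    by (simp_all only:) (intro open_vimage closed_vimage; simp add: open_discrete closed_def)+
  then show "openin (top_of_set (paths N)) (paths N \<inter> U m)"
    and "closedin (top_of_set (paths N)) (paths N \<inter> U m)"
    by (simp_all add: openin_open_Int closedin_closed_Int)
  fix x y :: "nat \<Rightarrow> nat" assume "x \<noteq> y"
  then obtain i where "x i \<noteq> y i" by auto
  then show "\<exists>m. x \<in> U m \<longleftrightarrow> y \<notin> U m"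
    using U_prod_encode[of i "x i"] by (intro exI[of _ "prod_encode (i, x i)"]) auto
next
  fix x V assume x: "x \<in> V" and "openin (top_of_set (paths N)) V"
  then obtain W where W: "open W" "V = paths N \<inter> W" by (auto simp: openin_open)
  obtain n where n: "\<And>y. (\<And>i. i < n \<Longrightarrow> y i = x i) \<Longrightarrow> y \<in> W"
    using open_contains_cylinder[OF W(1), of x] x W(2) by auto
  obtain q where "q \<in> paths N" "q \<noteq> x" "\<And>i. i < n \<Longrightarrow> q i = x i"
    using paths_not_isolated[of x N n] x W(2) assms by auto
  then show "\<exists>y\<in>V. y \<noteq> x" using n W(2) by auto
qed (use compact_paths zero_in_paths[OF assms] in auto)

lemma successor_const: "successor N (\<lambda>_. N + j) = (\<lambda>_. 0)"
  by (simp add: successor_def fun_eq_iff)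

lemma successor_leading_zeros:
  assumes "successor N p \<noteq> (\<lambda>_. 0)" "0 < N"
  obtains n where "p n < N" "\<And>i. i < n \<Longrightarrow> N \<le> p i" "\<And>i. i < n \<Longrightarrow> successor N p i = 0"
    "successor N p n \<noteq> 0" "\<And>i. n < i \<Longrightarrow> successor N p i = p i"
proof -
  have "\<exists>n. p n < N"
  proof (rule ccontr)
    assume "\<not> ?thesis"
    then have "successor N p k = 0" for k by (simp add: successor_def not_less)
    then show False using assms(1) by auto
  qed
  then obtain n where n: "p n < N" "\<And>i. i < n \<Longrightarrow> N \<le> p i"
    using exists_least_iff[of "\<lambda>n. p n < N"] by (auto simp: not_less)
  show ?thesis
  proof (rule that[of n])
    show "successor N p i = 0" if "i < n" for i using n(2) that by (auto simp: successor_def)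
    show "successor N p n \<noteq> 0" using n assms(2) by (auto simp: successor_def)
    show "successor N p i = p i" if "n < i" for i
      using n(1) that by (auto simp: successor_def not_le)
  qed (use n in auto)
qed

lemma successor_inj:
  assumes p: "p \<in> paths N" and q: "q \<in> paths N" and "0 < N"
    and eq: "successor N p = successor N q" and nonzero: "successor N p \<noteq> (\<lambda>_. 0)"
  shows "p = q"
proof -
  obtain n where n: "p n < N" "\<And>i. i < n \<Longrightarrow> N \<le> p i" "\<And>i. i < n \<Longrightarrow> successor N p i = 0"
    "successor N p n \<noteq> 0" "\<And>i. n < i \<Longrightarrow> successor N p i = p i"
    using successor_leading_zeros[OF nonzero \<open>0 < N\<close>] by metis
  obtain m where m: "q m < N" "\<And>i. i < m \<Longrightarrow> N \<le> q i" "\<And>i. i < m \<Longrightarrow> successor N q i = 0"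
    "successor N q m \<noteq> 0" "\<And>i. m < i \<Longrightarrow> successor N q i = q i"
    using successor_leading_zeros[of N q] nonzero \<open>0 < N\<close> eq by metis
  have [simp]: "m = n" using n(3,4) m(3,4) eq by (metis linorder_neqE_nat)
  have above: "p i = q i" if "n < i" for i using n(5) m(5) eq that by simp
  have "successor N p n = (if Suc (p n) < N then Suc (p n) else N + p (Suc n) mod N)"
    "successor N q n = (if Suc (q n) < N then Suc (q n) else N + q (Suc n) mod N)"
    using n(1,2) m(1,2) by (auto simp: successor_def)
  then have at: "p n = q n" using n(1) m(1) eq by (auto split: if_splits)
  have below: "p i = q i" if "i < n" for i
    by (rule paths_eq_below[OF p q _ _ that]) (use n(2) m(2) at in auto)
  show ?thesis using above at below by (metis ext linorder_neqE_nat)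
qed

text \<open>Position in the tower of height \<open>(N + 1) ^ n\<close>: the successor map acts on it as an odometer.\<close>

definition tower_rank :: "nat \<Rightarrow> nat \<Rightarrow> (nat \<Rightarrow> nat) \<Rightarrow> nat" where
  "tower_rank N n p = (\<Sum>i<n. min (p i) N * Suc N ^ i)"

lemma tower_rank_0 [simp]: "tower_rank N 0 p = 0"
  by (simp add: tower_rank_def)

lemma tower_rank_Suc: "tower_rank N (Suc n) p = tower_rank N n p + min (p n) N * Suc N ^ n"
  by (simp add: tower_rank_def)

lemma tower_rank_less: "tower_rank N n p < Suc N ^ n"
proof (induction n)
  case (Suc n)
  have "min (p n) N * Suc N ^ n \<le> N * Suc N ^ n" by (rule mult_right_mono) auto
  then show ?case using Suc unfolding tower_rank_Suc power_Suc mult_Suc by linarith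
qed simp

lemma tower_rank_add_eqD:
  assumes "tower_rank N n p + c * Suc N ^ n = tower_rank N n q + d * Suc N ^ n"
  shows "tower_rank N n p = tower_rank N n q" "c = d"
proof -
  have "(tower_rank N n r + e * Suc N ^ n) mod Suc N ^ n = tower_rank N n r"
    "(tower_rank N n r + e * Suc N ^ n) div Suc N ^ n = e" for r e
    using tower_rank_less[of N n r] by simp_all
  then show "tower_rank N n p = tower_rank N n q" "c = d" using assms by metis+
qed

lemma tower_rank_eqD:
  assumes "tower_rank N n p = tower_rank N n q" "i < n"
  shows "min (p i) N = min (q i) N"
  using assms
proof (induction n)
  case (Suc n)
  then show ?case using tower_rank_add_eqD[of N n p _ q] by (auto simp: tower_rank_Suc less_Suc_eq)
qed simp

lemma tower_rank_full: "\<forall>i<n. N \<le> p i \<Longrightarrow> Suc (tower_rank N n p) = Suc N ^ n"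
  by (induction n) (simp_all add: tower_rank_def)

lemma tower_rank_successor:
  "tower_rank N n (successor N p) = (if \<forall>i<n. N \<le> p i then 0 else Suc (tower_rank N n p))"
proof (induction n)
  case (Suc n)
  consider "\<forall>i<Suc n. N \<le> p i" | "\<forall>i<n. N \<le> p i" "p n < N" | "\<not> (\<forall>i<n. N \<le> p i)"
    by (metis less_Suc_eq not_le)
  then show ?case
  proof cases
    case 1
    then have "successor N p n = 0" by (simp add: successor_def)
    then show ?thesis using 1 Suc by (simp add: tower_rank_Suc)
  next
    case 2
    then have "min (successor N p n) N = Suc (p n)" by (auto simp: successor_def)
    then show ?thesis using 2 Suc tower_rank_full[OF 2(1)] by (auto simp: tower_rank_Suc)
  next
    case 3
    then have "successor N p n = p n" by (auto simp: successor_def)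
    moreover have "\<not> (\<forall>i<Suc n. N \<le> p i)" using 3 less_SucI by blast
    ultimately show ?thesis using 3 Suc by (auto simp: tower_rank_Suc)
  qed
qed simp

lemma tower_rank_successor_mod:
  "tower_rank N n (successor N p) = Suc (tower_rank N n p) mod Suc N ^ n"
proof (cases "\<forall>i<n. N \<le> p i")
  case True
  then show ?thesis using tower_rank_full[OF True] by (simp add: tower_rank_successor)
next
  case False
  then have "tower_rank N n (successor N p) = Suc (tower_rank N n p)"
    using tower_rank_successor[of N n p] by (simp only: if_False)
  then show ?thesis using tower_rank_less[of N n "successor N p"] by simp
qed

lemma tower_rank_funpow:
  "tower_rank N n ((successor N ^^ m) p) = (tower_rank N n p + m) mod Suc N ^ n"
proof (induction m)
  case 0
  then show ?case using tower_rank_less[of N n p] by simp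
next
  case (Suc m)
  then show ?case
    by (simp only: funpow.simps o_apply tower_rank_successor_mod add_Suc_right mod_Suc_eq)
qed

lemma tower_rank_determines_prefix:
  assumes p: "p \<in> paths N" and w: "w \<in> paths N" and "0 < N"
    and rank: "tower_rank N (Suc n) p = tower_rank N n w + (w n mod N) * Suc N ^ n"
    and "i < n"
  shows "p i = w i"
proof (rule paths_eq_below[OF p w _ _ \<open>i < n\<close>])
  have eq: "tower_rank N n p = tower_rank N n w" "min (p n) N = w n mod N"
    using rank tower_rank_add_eqD unfolding tower_rank_Suc by blast+
  show "min (p i) N = min (w i) N" if "i < n" for i using tower_rank_eqD[OF eq(1) that] .
  have "w n mod N < N" using \<open>0 < N\<close> by simp
  then show "p n mod N = w n mod N" using eq(2) by (auto simp: min_def split: if_splits)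
qed

lemma successor_visits_cylinder_periodically:
  assumes p: "p \<in> paths N" and w: "w \<in> paths N" and "0 < N"
  obtains q r where "0 < q" "\<And>m i. i < n \<Longrightarrow> (successor N ^^ (r + q * m)) p i = w i"
proof -
  define q where "q = Suc N ^ Suc n"
  define target where "target = tower_rank N n w + (w n mod N) * Suc N ^ n"
  define r where "r = target + (q - tower_rank N (Suc n) p)"
  have "w n mod N \<le> N" using \<open>0 < N\<close> by (simp add: less_imp_le)
  then have "(w n mod N) * Suc N ^ n \<le> N * Suc N ^ n" by (rule mult_right_mono) simp
  then have "target < q"
    using tower_rank_less[of N n w] unfolding target_def q_def power_Suc mult_Suc by linarith
  have "tower_rank N (Suc n) p < q" using tower_rank_less[of N "Suc n" p] by (simp add: q_def)
  then have "tower_rank N (Suc n) p + (r + q * m) = target + q * (m + 1)" for m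
    by (simp add: r_def algebra_simps)
  then have "(tower_rank N (Suc n) p + (r + q * m)) mod q = target" for m
    using \<open>target < q\<close> by (simp only: mod_mult_self2) simp
  then have "tower_rank N (Suc n) ((successor N ^^ (r + q * m)) p) = target" for m
    unfolding tower_rank_funpow q_def .
  moreover have "(successor N ^^ m) p \<in> paths N" for m
    by (induction m) (auto intro: successor_in_paths p \<open>0 < N\<close>)
  ultimately have "(successor N ^^ (r + q * m)) p i = w i" if "i < n" for m i
    using tower_rank_determines_prefix[OF _ w \<open>0 < N\<close> _ that] unfolding target_def by blast
  moreover have "0 < q" by (simp add: q_def)
  ultimately show ?thesis using that by blast
qed

locale branched_minimal_system =
  fixes B :: "'b::topological_space set" and f :: "'b \<Rightarrow> 'b" and b :: 'b
    and N :: nat and \<iota> :: "'b \<Rightarrow> nat"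
  assumes compact_B: "compact B"
    and continuous_on_f: "continuous_on B f"
    and f_in: "z \<in> B \<Longrightarrow> f z \<in> B"
    and b_in: "b \<in> B"
    and continuous_on_index: "continuous_on B \<iota>"
    and index_less: "z \<in> B \<Longrightarrow> \<iota> z < N"
    and index_fibre: "\<iota> ` {z \<in> B. f z = b} = {..<N}"
    and inj_off_b: "\<lbrakk>y \<in> B; z \<in> B; f y = f z; f z \<noteq> b\<rbrakk> \<Longrightarrow> y = z"
    and visits_periodically:
      "\<lbrakk>y \<in> B; z \<in> B; open U; z \<in> U\<rbrakk> \<Longrightarrow> \<exists>r q. 0 < q \<and> (\<forall>m. (f ^^ (r + q * m)) y \<in> U)"
begin

lemma funpow_in: "z \<in> B \<Longrightarrow> (f ^^ n) z \<in> B"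
  by (induction n) (auto intro: f_in)

end

lemma branched_minimal_system_paths:
  assumes "0 < N"
  shows "branched_minimal_system (paths N) (successor N) (\<lambda>_. 0) N (\<lambda>p. p 0 mod N)"
proof
  show "continuous_on (paths N) (\<lambda>p. p 0 mod N)"
    by (rule continuous_on_finite_coordinates[of 0]) simp
  show "(\<lambda>p. p 0 mod N) ` {p \<in> paths N. successor N p = (\<lambda>_. 0)} = {..<N}"
  proof (intro antisym subsetI)
    fix j assume "j \<in> {..<N}"
    then show "j \<in> (\<lambda>p. p 0 mod N) ` {p \<in> paths N. successor N p = (\<lambda>_. 0)}"
      using const_in_paths successor_const by (intro image_eqI[of _ _ "\<lambda>_. N + j"]) auto
  qed (use assms in auto)
next
  fix p w :: "nat \<Rightarrow> nat" and U assume p: "p \<in> paths N" and w: "w \<in> paths N" and "open U" "w \<in> U"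
  then obtain n where n: "\<And>p. (\<And>i. i < n \<Longrightarrow> p i = w i) \<Longrightarrow> p \<in> U"
    using open_contains_cylinder by blast
  obtain q r where "0 < q" "\<And>m i. i < n \<Longrightarrow> (successor N ^^ (r + q * m)) p i = w i"
    using successor_visits_cylinder_periodically[OF p w assms] by blast
  then show "\<exists>r q. 0 < q \<and> (\<forall>m. (successor N ^^ (r + q * m)) p \<in> U)" using n by blast
qed (use assms compact_paths continuous_on_successor successor_in_paths zero_in_paths successor_inj
    in \<open>auto\<close>)

lemma (in branched_minimal_system) homeomorphic_copy:
  assumes hom: "homeomorphism B B' \<phi> \<psi>"
  shows "branched_minimal_system B' (\<lambda>z. \<phi> (f (\<psi> z))) (\<phi> b) N (\<lambda>z. \<iota> (\<psi> z))"
proof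
  have \<phi>: "\<psi> (\<phi> z) = z" "\<phi> z \<in> B'" if "z \<in> B" for z
    using hom that by (auto simp: homeomorphism_def)
  have \<psi>: "\<phi> (\<psi> z) = z" "\<psi> z \<in> B" if "z \<in> B'" for z
    using hom that by (auto simp: homeomorphism_def)
  have cont: "continuous_on B \<phi>" "continuous_on B' \<psi>"
    using hom by (auto simp: homeomorphism_def)
  have \<phi>_eq_iff: "\<phi> y = \<phi> z \<longleftrightarrow> y = z" if "y \<in> B" "z \<in> B" for y z using \<phi> that by metis
  show "compact B'"
    using compact_continuous_image[OF cont(1) compact_B] hom by (simp add: homeomorphism_def)
  show "continuous_on B' (\<lambda>z. \<phi> (f (\<psi> z)))" "continuous_on B' (\<lambda>z. \<iota> (\<psi> z))"
    by (intro continuous_on_compose2[OF cont(1)] continuous_on_compose2[OF continuous_on_f]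
        continuous_on_compose2[OF continuous_on_index] cont(2); use \<psi> f_in in auto)+
  show "(\<lambda>z. \<iota> (\<psi> z)) ` {z \<in> B'. \<phi> (f (\<psi> z)) = \<phi> b} = {..<N}"
  proof -
    have "{z \<in> B'. \<phi> (f (\<psi> z)) = \<phi> b} = \<phi> ` {z \<in> B. f z = b}"
      using \<phi> \<psi> \<phi>_eq_iff f_in b_in by (auto simp: image_iff) (metis \<psi>)
    then show ?thesis using \<phi> by (simp add: image_image index_fibre[symmetric])
  qed
  show "y = z" if "y \<in> B'" "z \<in> B'" "\<phi> (f (\<psi> y)) = \<phi> (f (\<psi> z))" "\<phi> (f (\<psi> z)) \<noteq> \<phi> b" for y z
    using that \<psi> f_in b_in \<phi>_eq_iff inj_off_b by metis
  fix y z U assume y: "y \<in> B'" and z: "z \<in> B'" and U: "open U" "z \<in> U"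
  obtain W where W: "open W" "W \<inter> B = \<phi> -` U \<inter> B"
    using continuous_on_open_invariant[of B \<phi>] cont(1) U(1) by blast
  have "\<psi> z \<in> W" using W(2) \<psi>[OF z] U(2) by auto
  then obtain r q where rq: "0 < q" "\<And>m. (f ^^ (r + q * m)) (\<psi> y) \<in> W"
    using visits_periodically[OF \<psi>(2)[OF y] \<psi>(2)[OF z] W(1)] by blast
  have iterate: "((\<lambda>z. \<phi> (f (\<psi> z))) ^^ m) y = \<phi> ((f ^^ m) (\<psi> y))" for m
    by (induction m) (use y \<psi> \<phi> funpow_in in auto)
  have "((\<lambda>z. \<phi> (f (\<psi> z))) ^^ (r + q * m)) y \<in> U" for m
    unfolding iterate using W(2) rq(2) funpow_in[OF \<psi>(2)[OF y]] by blast
  then show "\<exists>r q. 0 < q \<and> (\<forall>m. ((\<lambda>z. \<phi> (f (\<psi> z))) ^^ (r + q * m)) y \<in> U)" using rq(1) by blast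
qed (use hom in \<open>auto simp: homeomorphism_def f_in b_in index_less\<close>)

lemma ex_branched_minimal_system_cantor:
  assumes "0 < N"
  obtains f b \<iota> where "branched_minimal_system cantor_ternary f b N \<iota>"
proof -
  obtain \<phi> \<psi> where "homeomorphism (paths N) cantor_ternary \<phi> \<psi>"
    using cantor_set_paths[OF assms] by (auto simp: cantor_set_def homeomorphic_def)
  from branched_minimal_system.homeomorphic_copy[OF branched_minimal_system_paths[OF assms] this]
  show ?thesis by (rule that)
qed

section \<open>Circles in graphs\<close>

abbreviation unit_circle :: "complex set" where
  "unit_circle \<equiv> sphere 0 1"

lemma compact_circle: "circle C \<Longrightarrow> compact C"
  using homeomorphic_compactness[of C unit_circle] by (simp add: circle_def)

lemma circle_unit_circle: "circle unit_circle"
  by (simp add: circle_def homeomorphic_refl)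

lemma circle_injective_image:
  fixes g :: "'a::topological_space \<Rightarrow> 'b::t2_space"
  assumes "circle C" "continuous_on C g" "inj_on g C"
  shows "circle (g ` C)"
proof -
  have "C homeomorphic g ` C"
    by (rule homeomorphic_compact[OF compact_circle[OF assms(1)] assms(2) refl assms(3)])
  then show ?thesis
    using assms(1) homeomorphic_sym homeomorphic_trans unfolding circle_def by blast
qed

lemma circle_embedding:
  assumes "circle C"
  obtains \<eta> where "continuous_on C \<eta>" "inj_on \<eta> C" "\<eta> ` C = unit_circle"
proof -
  obtain \<eta> g where "homeomorphism C unit_circle \<eta> g"
    using assms by (auto simp: circle_def homeomorphic_def)
  then have "continuous_on C \<eta>" "\<eta> ` C = unit_circle" "\<forall>x\<in>C. g (\<eta> x) = x"
    by (auto simp: homeomorphism_def)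
  then show ?thesis using that by (metis inj_on_inverseI)
qed

lemma circle_simple_path:
  fixes C :: "'a::t2_space set"
  assumes "circle C" "a \<in> C"
  obtains \<gamma> where "simple_path \<gamma>" "path_image \<gamma> = C" "pathstart \<gamma> = a" "pathfinish \<gamma> = a"
proof -
  obtain \<phi> \<psi> where \<phi>: "homeomorphism unit_circle C \<phi> \<psi>"
    using assms(1) homeomorphic_sym by (fastforce simp: circle_def homeomorphic_def)
  define \<delta> where "\<delta> = \<phi> \<circ> circlepath 0 1"
  have inj: "inj_on \<phi> unit_circle" using \<phi> by (metis homeomorphism_def inj_on_inverseI)
  have \<delta>: "simple_path \<delta>" "path_image \<delta> = C" "pathfinish \<delta> = pathstart \<delta>"
    unfolding \<delta>_def using \<phi> inj
    by (simp_all add: simple_path_continuous_image simple_path_circlepath homeomorphism_def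
        path_image_compose pathstart_compose pathfinish_compose)
  obtain t where t: "t \<in> {0..1}" "\<delta> t = a" using \<delta>(2) assms(2) by (auto simp: path_image_def)
  show ?thesis
  proof (rule that[of "shiftpath t \<delta>"])
    show "simple_path (shiftpath t \<delta>)" using simple_path_shiftpath \<delta>(1,3) t(1) by auto
    show "path_image (shiftpath t \<delta>) = C" using path_image_shiftpath[OF t(1) \<delta>(3)] \<delta>(2) by simp
    show "pathstart (shiftpath t \<delta>) = a" using t by (simp add: pathstart_shiftpath)
    show "pathfinish (shiftpath t \<delta>) = a" using t \<delta>(3) by (simp add: pathfinish_shiftpath)
  qed
qed

lemma connected_circle: "circle C \<Longrightarrow> connected C"
  using homeomorphic_connectedness[of C unit_circle] connected_sphere[of "0::complex" 1]
  by (simp add: circle_def)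

lemma loop_freeD:
  "\<lbrakk>loop_free \<gamma>; s \<in> {0..1}; t \<in> {0..1}; \<gamma> s = \<gamma> t\<rbrakk> \<Longrightarrow> s = t \<or> s = 0 \<and> t = 1 \<or> s = 1 \<and> t = 0"
  by (simp add: loop_free_def)

lemma circle_islimpt:
  fixes C :: "'a::metric_space set"
  assumes "circle C" "x \<in> C"
  shows "x islimpt C"
proof -
  obtain \<gamma> where \<gamma>: "simple_path \<gamma>" "path_image \<gamma> = C" "pathstart \<gamma> = x" "pathfinish \<gamma> = x"
    using circle_simple_path[OF assms] by blast
  have "loop_free \<gamma>" using \<gamma>(1) by (simp add: simple_path_def)
  then have "\<gamma> (1/2) \<noteq> \<gamma> 0" using loop_freeD[of \<gamma> "1/2" 0] by auto
  moreover have "\<gamma> (1/2) \<in> C" using \<gamma>(2) by (force simp: path_image_def)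
  ultimately show ?thesis
    using assms(2) \<gamma>(3) connected_circle[OF assms(1)]
    by (intro connected_imp_perfect) (auto simp: pathstart_def)
qed

definition ends :: "(real \<Rightarrow> 'a::topological_space) \<Rightarrow> 'a set" where
  "ends g = {pathstart g, pathfinish g}"

definition edge_family :: "(real \<Rightarrow> 'a::topological_space) set \<Rightarrow> bool" where
  "edge_family \<G> \<longleftrightarrow> finite \<G> \<and> (\<forall>g\<in>\<G>. arc g) \<and>
     (\<forall>g\<in>\<G>. \<forall>g'\<in>\<G>. path_image g \<noteq> path_image g' \<longrightarrow>
        path_image g \<inter> path_image g' \<subseteq> ends g \<inter> ends g')"

lemma is_graph_iff_edge_family:
  "is_graph G \<longleftrightarrow> (\<exists>\<G>. edge_family \<G> \<and> \<G> \<noteq> {} \<and> G = \<Union>(path_image ` \<G>))"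
  unfolding is_graph_def edge_family_def ends_def by blast

lemma edge_family_subset: "edge_family \<G> \<Longrightarrow> \<H> \<subseteq> \<G> \<Longrightarrow> edge_family \<H>"
  unfolding edge_family_def by (blast intro: finite_subset)

lemma edge_family_Un:
  assumes "edge_family \<G>" "edge_family \<H>"
    and "\<And>g h. \<lbrakk>g \<in> \<G>; h \<in> \<H>\<rbrakk> \<Longrightarrow> path_image g \<inter> path_image h \<subseteq> ends g \<inter> ends h"
  shows "edge_family (\<G> \<union> \<H>)"
  using assms unfolding edge_family_def by (auto; blast)

lemma compact_Union_edges: "edge_family \<G> \<Longrightarrow> compact (\<Union>(path_image ` \<G>))"
  by (auto simp: edge_family_def intro: compact_arc_image)

lemma compact_is_graph: "is_graph G \<Longrightarrow> compact G"
  unfolding is_graph_iff_edge_family using compact_Union_edges by blast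

lemma arc_path_image_minus_ends: "arc g \<Longrightarrow> path_image g - ends g = g ` {0<..<1}"
  using simple_path_endless[OF arc_imp_simple_path, of g] by (simp add: ends_def)

lemma openin_edge_interior:
  fixes \<G> :: "(real \<Rightarrow> 'a::t2_space) set"
  assumes \<G>: "edge_family \<G>" and g: "g \<in> \<G>"
  shows "openin (top_of_set (\<Union>(path_image ` \<G>))) (g ` {0<..<1})"
proof -
  let ?others = "{g' \<in> \<G>. path_image g' \<noteq> path_image g}"
  let ?K = "\<Union>(path_image ` ?others) \<union> ends g"
  have "compact (\<Union>(path_image ` ?others))"
    by (intro compact_Union_edges edge_family_subset[OF \<G>]) auto
  then have "closed ?K" by (intro closed_Un compact_imp_closed) (auto simp: ends_def)
  have "path_image g' \<inter> path_image g \<subseteq> ends g" if "g' \<in> ?others" for g'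
    using \<G> g that unfolding edge_family_def by blast
  then have "path_image g - ends g = \<Union>(path_image ` \<G>) - ?K" using g by blast
  moreover have "arc g" using \<G> g by (simp add: edge_family_def)
  ultimately have "g ` {0<..<1} = \<Union>(path_image ` \<G>) - ?K"
    by (simp only: arc_path_image_minus_ends)
  then show ?thesis
    using openin_open_Int[OF open_Compl[OF \<open>closed ?K\<close>], of "\<Union>(path_image ` \<G>)"]
    by (simp add: Diff_eq)
qed

lemma circle_local_curve:
  fixes C :: "'a::t2_space set"
  assumes "circle C" "x \<in> C"
  obtains \<delta> :: "real \<Rightarrow> 'a" where "continuous_on {0<..<1} \<delta>" "inj_on \<delta> {0<..<1}"
    "\<delta> ` {0<..<1} \<subseteq> C" "\<delta> (1/2) = x"
proof -
  obtain \<gamma> where \<gamma>: "simple_path \<gamma>" "path_image \<gamma> = C" "pathstart \<gamma> = x" "pathfinish \<gamma> = x"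
    using circle_simple_path[OF assms] by blast
  define \<delta> where "\<delta> = shiftpath (1/2) \<gamma>"
  have \<delta>: "simple_path \<delta>" "path_image \<delta> = C" "\<delta> (1/2) = x"
    using simple_path_shiftpath[OF \<gamma>(1)] path_image_shiftpath[of "1/2" \<gamma>] \<gamma>
    by (auto simp: \<delta>_def shiftpath_def pathfinish_def pathstart_def)
  show ?thesis
  proof (rule that[of \<delta>])
    show "continuous_on {0<..<1} \<delta>"
      using \<delta>(1) by (auto simp: simple_path_def path_def intro: continuous_on_subset)
    show "inj_on \<delta> {0<..<1}" using \<delta>(1) by (rule simple_path_inj_on)
    show "\<delta> ` {0<..<1} \<subseteq> C" using \<delta>(2) by (auto simp: path_image_def)
  qed (rule \<delta>(3))
qed

text \<open>Around each of its points the circle is a curve, which near the edge can be read as an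
  injective continuous real function of a real parameter; such a function has an open image.\<close>

lemma open_circle_parameters:
  fixes C :: "'a::t2_space set"
  assumes C: "circle C" "C \<subseteq> G" and g: "arc g"
    and edge: "openin (top_of_set G) (g ` {0<..<1})"
  shows "open {t \<in> {0<..<1}. g t \<in> C}"
proof (subst open_subopen, rule ballI)
  fix t assume "t \<in> {t \<in> {0<..<1}. g t \<in> C}"
  then have t: "t \<in> {0<..<1}" "g t \<in> C" by auto
  obtain k where k: "homeomorphism {0..1} (g ` {0..1}) g k"
    using homeomorphism_arc[OF g] unfolding path_image_def by blast
  have k_g: "k (g u) = u" if "u \<in> {0..1}" for u using k that by (simp add: homeomorphism_def)
  obtain \<delta> :: "real \<Rightarrow> 'a" where \<delta>: "continuous_on {0<..<1} \<delta>" "inj_on \<delta> {0<..<1}"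
    "\<delta> ` {0<..<1} \<subseteq> C" "\<delta> (1/2) = g t"
    by (rule circle_local_curve[OF C(1) t(2)])
  obtain W where W: "open W" "g ` {0<..<1} = G \<inter> W" using edge by (auto simp: openin_open)
  define S where "S = {0<..<1} \<inter> \<delta> -` W"
  have \<delta>_S: "\<delta> ` S \<subseteq> g ` {0<..<1}" using W(2) C(2) \<delta>(3) by (auto simp: S_def)
  have "open S" unfolding S_def by (rule continuous_open_preimage[OF \<delta>(1) _ W(1)]) simp
  moreover have "continuous_on S (k \<circ> \<delta>)"
  proof (rule continuous_on_compose)
    show "continuous_on S \<delta>" using \<delta>(1) by (rule continuous_on_subset) (simp add: S_def)
    have "g ` {0<..<1} \<subseteq> g ` {0..1}" by (intro image_mono) auto
    with \<delta>_S have "\<delta> ` S \<subseteq> g ` {0..1}" by (rule order.trans)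
    then show "continuous_on (\<delta> ` S) k"
      using k unfolding homeomorphism_def by (metis continuous_on_subset)
  qed
  moreover have "inj_on (k \<circ> \<delta>) S"
  proof (rule comp_inj_on)
    show "inj_on \<delta> S" using \<delta>(2) by (rule inj_on_subset) (simp add: S_def)
    show "inj_on k (\<delta> ` S)" by (rule inj_on_subset[OF _ \<delta>_S]) (auto simp: inj_on_def k_g)
  qed
  ultimately have "open ((k \<circ> \<delta>) ` S)" by (rule injective_into_1d_imp_open_map_UNIV) simp
  moreover have "t \<in> (k \<circ> \<delta>) ` S"
  proof (rule image_eqI[of _ _ "1/2"])
    show "1/2 \<in> S" using \<delta>(4) t(1) W(2) by (auto simp: S_def)
  qed (use k_g t(1) \<delta>(4) in auto)
  moreover have "(k \<circ> \<delta>) u \<in> {t \<in> {0<..<1}. g t \<in> C}" if u: "u \<in> S" for u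
  proof -
    obtain v where "v \<in> {0<..<1}" "\<delta> u = g v" using \<delta>_S u by blast
    moreover have "\<delta> u \<in> C" using \<delta>(3) u by (auto simp: S_def)
    ultimately show ?thesis using k_g[of v] by auto
  qed
  ultimately show "\<exists>T. open T \<and> t \<in> T \<and> T \<subseteq> {t \<in> {0<..<1}. g t \<in> C}" by blast
qed

lemma circle_contains_edge:
  fixes C :: "'a::t2_space set"
  assumes C: "circle C" "C \<subseteq> G" and g: "arc g"
    and edge: "openin (top_of_set G) (g ` {0<..<1})" and meets: "C \<inter> g ` {0<..<1} \<noteq> {}"
  shows "path_image g \<subseteq> C"
proof -
  let ?T = "{t \<in> {0<..<1}. g t \<in> C}"
  have cont: "continuous_on {0..1} g" using g by (simp add: arc_def path_def)
  have closed_C: "closed C" using compact_circle[OF C(1)] by (rule compact_imp_closed)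
  have "openin (top_of_set {0<..<1}) ?T"
    using open_circle_parameters[OF C g edge] by (rule open_subset[rotated]) auto
  moreover have "closedin (top_of_set {0<..<1}) ({0<..<1} \<inter> g -` C)"
    by (intro continuous_closedin_preimage closed_C continuous_on_subset[OF cont]) auto
  moreover have "{0<..<1} \<inter> g -` C = ?T" by auto
  ultimately have "?T = {} \<or> ?T = {0<..<1}"
    using connected_clopen[of "{0<..<1::real}"] connected_Ioo by metis
  then have "g ` {0<..<1} \<subseteq> C" using meets by blast
  moreover have "closure {0<..<1::real} = {0..1}" by simp
  ultimately have "g ` {0..1} \<subseteq> C"
    using image_closure_subset[of "{0<..<1}" g C] cont closed_C by metis
  then show ?thesis by (simp add: path_image_def)
qed

lemma circle_minus_ends_subset:
  fixes C :: "'a::t2_space set"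
  assumes \<G>: "edge_family \<G>" and C: "circle C" "C \<subseteq> \<Union>(path_image ` \<G>)"
  shows "C - \<Union>(ends ` \<G>) \<subseteq> (\<Union>g\<in>{g \<in> \<G>. path_image g \<subseteq> C}. g ` {0<..<1})"
proof
  fix x assume x: "x \<in> C - \<Union>(ends ` \<G>)"
  then obtain g where g: "g \<in> \<G>" "x \<in> path_image g" using C(2) by blast
  have "arc g" using \<G> g(1) by (simp add: edge_family_def)
  have "x \<in> g ` {0<..<1}" using arc_path_image_minus_ends[OF \<open>arc g\<close>] g x by blast
  then have "path_image g \<subseteq> C"
    using circle_contains_edge[OF C \<open>arc g\<close> openin_edge_interior[OF \<G> g(1)]] x by blast
  then show "x \<in> (\<Union>g\<in>{g \<in> \<G>. path_image g \<subseteq> C}. g ` {0<..<1})"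
    using g(1) \<open>x \<in> g ` {0<..<1}\<close> by blast
qed

lemma circle_eq_Union_edges:
  fixes C :: "'a::metric_space set"
  assumes \<G>: "edge_family \<G>" and C: "circle C" "C \<subseteq> \<Union>(path_image ` \<G>)"
  shows "C = \<Union>(path_image ` {g \<in> \<G>. path_image g \<subseteq> C})" (is "C = ?E")
proof
  let ?V = "\<Union>(ends ` \<G>)"
  have "finite ?V" using \<G> by (auto simp: edge_family_def ends_def)
  have "closed ?E"
    by (intro compact_imp_closed compact_Union_edges edge_family_subset[OF \<G>]) auto
  have "(\<Union>g\<in>{g \<in> \<G>. path_image g \<subseteq> C}. g ` {0<..<1}) \<subseteq> ?E"
    unfolding path_image_def by (intro UN_mono image_mono) auto
  with circle_minus_ends_subset[OF \<G> C] have C_minus_V: "C - ?V \<subseteq> ?E" by (rule order.trans)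
  show "C \<subseteq> ?E"
  proof
    fix x assume "x \<in> C"
    then have "x islimpt C" by (rule circle_islimpt[OF C(1)])
    moreover have "C \<subseteq> ?V \<union> (C - ?V)" by blast
    ultimately have "x islimpt (?V \<union> (C - ?V))" by (rule islimpt_subset)
    then have "x islimpt (C - ?V)" using islimpt_Un_finite[OF \<open>finite ?V\<close>] by blast
    then show "x \<in> ?E" using C_minus_V \<open>closed ?E\<close> islimpt_subset closed_limpt by blast
  qed
qed blast

lemma is_graph_Un_circles:
  assumes "is_graph G" "circle C1" "C1 \<subseteq> G" "circle C2" "C2 \<subseteq> G"
  shows "is_graph (C1 \<union> C2)"
proof -
  obtain \<G> where \<G>: "edge_family \<G>" "G = \<Union>(path_image ` \<G>)"
    using assms(1) unfolding is_graph_iff_edge_family by blast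
  define \<H> where "\<H> C = {g \<in> \<G>. path_image g \<subseteq> C}" for C
  have C_eq: "C1 = \<Union>(path_image ` \<H> C1)" "C2 = \<Union>(path_image ` \<H> C2)"
    unfolding \<H>_def using circle_eq_Union_edges[OF \<G>(1)] assms(2-) \<G>(2) by blast+
  then have "C1 \<union> C2 = \<Union>(path_image ` (\<H> C1 \<union> \<H> C2))" by blast
  moreover have "edge_family (\<H> C1 \<union> \<H> C2)"
    by (rule edge_family_subset[OF \<G>(1)]) (auto simp: \<H>_def)
  moreover have "C1 \<noteq> {}" using assms(2) by (auto simp: circle_def)
  then have "\<H> C1 \<noteq> {}" using C_eq(1) by auto
  ultimately show ?thesis unfolding is_graph_iff_edge_family by blast
qed

lemma circle_openin_minus_finite:
  assumes "is_graph G" "circle C" "C \<subseteq> G"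
  obtains V where "finite V" "openin (top_of_set G) (C - V)"
proof -
  obtain \<G> where \<G>: "edge_family \<G>" "G = \<Union>(path_image ` \<G>)"
    using assms(1) unfolding is_graph_iff_edge_family by blast
  define V where "V = \<Union>(ends ` \<G>)"
  define I where "I = (\<Union>g\<in>{g \<in> \<G>. path_image g \<subseteq> C}. g ` {0<..<1})"
  have "finite V" using \<G>(1) by (auto simp: V_def edge_family_def ends_def)
  have "I \<subseteq> C" by (auto simp: I_def path_image_def)
  moreover have "C - V \<subseteq> I"
    using circle_minus_ends_subset[OF \<G>(1) assms(2)] assms(3) unfolding \<G>(2) I_def V_def .
  ultimately have "C - V = I \<inter> (G \<inter> - V)" using assms(3) by blast
  moreover have "openin (top_of_set G) I"
    unfolding \<G>(2) I_def by (intro openin_Union) (auto intro: openin_edge_interior[OF \<G>(1)])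
  moreover have "openin (top_of_set G) (G \<inter> - V)"
    by (intro openin_open_Int open_Compl finite_imp_closed \<open>finite V\<close>)
  ultimately show ?thesis using that[OF \<open>finite V\<close>] by (metis openin_Int)
qed

lemma edge_family_image:
  fixes f :: "'a::topological_space \<Rightarrow> 'b::topological_space"
  assumes \<G>: "edge_family \<G>"
    and f: "continuous_on (\<Union>(path_image ` \<G>)) f" "inj_on f (\<Union>(path_image ` \<G>))"
  shows "edge_family ((\<circ>) f ` \<G>)"
  unfolding edge_family_def
proof (intro conjI ballI impI)
  show "finite ((\<circ>) f ` \<G>)" using \<G> by (simp add: edge_family_def)
  have f_edge: "continuous_on (path_image g) f" "inj_on f (path_image g)" if "g \<in> \<G>" for g
    using that continuous_on_subset[OF f(1)] inj_on_subset[OF f(2)] by blast+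
  show "arc g" if "g \<in> (\<circ>) f ` \<G>" for g
    using that \<G> f_edge unfolding edge_family_def
    by (auto simp: arc_def path_def path_image_def intro: continuous_on_compose comp_inj_on)
  fix g g' assume "g \<in> (\<circ>) f ` \<G>" "g' \<in> (\<circ>) f ` \<G>" and ne: "path_image g \<noteq> path_image g'"
  then obtain a a' where a: "a \<in> \<G>" "a' \<in> \<G>" "g = f \<circ> a" "g' = f \<circ> a'" by blast
  then have "path_image a \<noteq> path_image a'" using ne by (metis path_image_compose)
  then have "path_image a \<inter> path_image a' \<subseteq> ends a \<inter> ends a'"
    using \<G> a(1,2) unfolding edge_family_def by blast
  moreover have "path_image g \<inter> path_image g' = f ` (path_image a \<inter> path_image a')"
    unfolding a path_image_compose by (rule inj_on_image_Int[OF f(2), symmetric]) (use a in auto)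
  ultimately show "path_image g \<inter> path_image g' \<subseteq> ends g \<inter> ends g'"
    unfolding a ends_def by (auto simp: pathstart_compose pathfinish_compose)
qed

lemma is_graph_injective_image:
  fixes f :: "'a::metric_space \<Rightarrow> 'b::metric_space"
  assumes "is_graph G" "continuous_on G f" "inj_on f G"
  shows "is_graph (f ` G)"
proof -
  obtain \<G> where \<G>: "edge_family \<G>" "\<G> \<noteq> {}" "G = \<Union>(path_image ` \<G>)"
    using assms(1) unfolding is_graph_iff_edge_family by blast
  then have "edge_family ((\<circ>) f ` \<G>)" using edge_family_image assms(2,3) by blast
  moreover have "f ` G = \<Union>(path_image ` (\<circ>) f ` \<G>)"
    unfolding \<G>(3) by (simp add: image_UN image_image path_image_compose)
  ultimately show ?thesis using \<G>(2) unfolding is_graph_iff_edge_family by blast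
qed

lemma circle_edge_family:
  fixes C :: "'a::real_normed_vector set"
  assumes "circle C" "a \<in> C"
  obtains \<G> where "edge_family \<G>" "\<Union>(path_image ` \<G>) = C" "\<forall>g\<in>\<G>. a \<in> ends g"
proof -
  obtain \<gamma> where \<gamma>: "simple_path \<gamma>" "path_image \<gamma> = C" "pathstart \<gamma> = a" "pathfinish \<gamma> = a"
    using circle_simple_path[OF assms] .
  obtain c where c: "c \<in> C" "c \<noteq> a"
    using circle_islimpt[OF assms] by (auto simp: islimpt_def)
  obtain u d where ud: "arc u" "arc d" "pathstart u = a" "pathfinish u = c" "pathstart d = c"
    "pathfinish d = a" "path_image u \<inter> path_image d = {a, c}" "path_image u \<union> path_image d = C"
    using exists_double_arc[of \<gamma> a c] \<gamma> assms(2) c by metis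
  then have ends: "ends u = {a, c}" "ends d = {a, c}" by (auto simp: ends_def)
  show ?thesis
  proof (rule that[of "{u, d}"])
    show "edge_family {u, d}" using ud ends by (auto simp: edge_family_def)
  qed (use ud ends in auto)
qed

lemma is_graph_joined_circles:
  fixes g :: "real \<Rightarrow> 'a::real_normed_vector"
  assumes C: "circle C1" "circle C2" "C1 \<inter> C2 = {}" and g: "arc g"
    and meets: "C1 \<inter> path_image g = {pathstart g}" "C2 \<inter> path_image g = {pathfinish g}"
  shows "is_graph (C1 \<union> C2 \<union> path_image g)"
proof -
  have a: "pathstart g \<in> C1" "pathfinish g \<in> C2" using meets by blast+
  obtain \<G> where \<G>: "edge_family \<G>" "\<Union>(path_image ` \<G>) = C1"
    "\<forall>u\<in>\<G>. pathstart g \<in> ends u"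
    by (rule circle_edge_family[OF C(1) a(1)])
  obtain \<H> where \<H>: "edge_family \<H>" "\<Union>(path_image ` \<H>) = C2"
    "\<forall>u\<in>\<H>. pathfinish g \<in> ends u"
    by (rule circle_edge_family[OF C(2) a(2)])
  have "edge_family (\<G> \<union> \<H>)"
    using C(3) \<G>(2) \<H>(2) by (intro edge_family_Un \<G>(1) \<H>(1)) blast
  moreover have "edge_family {g}" using g by (simp add: edge_family_def)
  moreover have "path_image u \<inter> path_image v \<subseteq> ends u \<inter> ends v" if "u \<in> \<G> \<union> \<H>" "v \<in> {g}" for u v
    using that meets \<G>(2,3) \<H>(2,3) unfolding ends_def by fastforce
  ultimately have "edge_family (\<G> \<union> \<H> \<union> {g})" by (rule edge_family_Un)
  moreover have "C1 \<union> C2 \<union> path_image g = \<Union>(path_image ` (\<G> \<union> \<H> \<union> {g}))"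
    using \<G>(2) \<H>(2) by auto
  ultimately show ?thesis unfolding is_graph_iff_edge_family by blast
qed

section \<open>Skew products from sections of a map onto the circle\<close>

lemma powers_dense_in_unit_circle:
  fixes \<rho> w :: complex
  assumes \<rho>: "norm \<rho> = 1" "\<And>n. 0 < n \<Longrightarrow> \<rho> ^ n \<noteq> 1" and w: "norm w = 1" and "0 < e"
  obtains k where "dist (\<rho> ^ k) w < e"
proof -
  define \<theta> where "\<theta> = Arg2pi \<rho> / (2 * pi)"
  define t where "t = Arg2pi w / (2 * pi)"
  have \<rho>_eq: "\<rho> = cis (2 * pi * \<theta>)" and w_eq: "w = cis (2 * pi * t)"
    using Arg2pi_eq[of \<rho>] Arg2pi_eq[of w] \<rho>(1) w by (simp_all add: \<theta>_def t_def cis_conv_exp)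
  have "\<theta> \<notin> \<rat>"
  proof
    assume "\<theta> \<in> \<rat>"
    then obtain i :: int and n :: nat where "\<theta> = of_int i / of_nat n" "n \<noteq> 0"
      unfolding Rats_eq_int_div_nat by blast
    then have "\<rho> ^ n = 1" unfolding \<rho>_eq Complex.DeMoivre by (simp add: cis_multiple_2pi)
    then show False using \<rho>(2) \<open>n \<noteq> 0\<close> by blast
  qed
  have "isCont (\<lambda>s. cis (2 * pi * s)) t"
    unfolding cis_conv_exp by (intro continuous_intros)
  then obtain d where d: "0 < d" "\<And>s. dist s t < d \<Longrightarrow> dist (cis (2 * pi * s)) w < e"
    using \<open>0 < e\<close> unfolding continuous_at_eps_delta w_eq by metis
  have "0 \<le> t" "t \<le> 1"
    using Arg2pi_ge_0[of w] Arg2pi_lt_2pi[of w] by (simp_all add: t_def)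
  then obtain k where "dist (frac (real k * \<theta>)) t < d"
    using Kronecker_approx_1_explicit[OF \<open>\<theta> \<notin> \<rat>\<close>, of t d] d(1) by (auto simp: dist_real_def)
  moreover have "\<rho> ^ k = cis (2 * pi * frac (real k * \<theta>))"
  proof -
    have "\<rho> ^ k = cis (2 * pi * (frac (real k * \<theta>) + of_int \<lfloor>real k * \<theta>\<rfloor>))"
      unfolding \<rho>_eq Complex.DeMoivre by (simp add: frac_def mult_ac)
    also have "\<dots> = cis (2 * pi * frac (real k * \<theta>)) * cis (2 * pi * of_int \<lfloor>real k * \<theta>\<rfloor>)"
      by (simp only: cis_mult distrib_left)
    finally show ?thesis by (simp only: cis_multiple_2pi Ints_of_int mult_1_right)
  qed
  ultimately show ?thesis using d(2) that by metis
qed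

lemma ex_not_root_of_unity:
  obtains \<rho> :: complex where "norm \<rho> = 1" "\<And>n. 0 < n \<Longrightarrow> \<rho> ^ n \<noteq> 1"
proof -
  have "countable (\<Union>n\<in>{1..}. {z :: complex. z ^ n = 1})"
    by (intro countable_UN countable_finite[OF finite_roots_unity]) auto
  moreover have "uncountable unit_circle"
    by (rule connected_uncountable[of _ 1 "-1"]) (simp_all add: connected_sphere)
  ultimately obtain \<rho> where "\<rho> \<in> unit_circle" "\<rho> \<notin> (\<Union>n\<in>{1..}. {z. z ^ n = 1})"
    by (meson countable_subset subsetI)
  then show ?thesis using that[of \<rho>] by (simp add: Suc_le_eq)
qed

locale circle_sections =
  fixes \<Gamma> :: "'c::t2_space set" and h :: "'c \<Rightarrow> complex" and N :: nat and s :: "nat \<Rightarrow> complex \<Rightarrow> 'c"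
  assumes compact_\<Gamma>: "compact \<Gamma>"
    and continuous_on_h: "continuous_on \<Gamma> h"
    and h_in: "x \<in> \<Gamma> \<Longrightarrow> h x \<in> unit_circle"
    and continuous_on_section: "k < N \<Longrightarrow> continuous_on unit_circle (s k)"
    and section_in: "\<lbrakk>k < N; w \<in> unit_circle\<rbrakk> \<Longrightarrow> s k w \<in> \<Gamma>"
    and h_section: "\<lbrakk>k < N; w \<in> unit_circle\<rbrakk> \<Longrightarrow> h (s k w) = w"

locale skew_product = branched_minimal_system B f b N \<iota> + circle_sections \<Gamma> h N s
  for B :: "'b::metric_space set" and f b N \<iota> and \<Gamma> :: "'c::metric_space set" and h s +
  fixes \<rho> :: complex
  assumes norm_\<rho>: "norm \<rho> = 1" and not_root_of_unity: "0 < n \<Longrightarrow> \<rho> ^ n \<noteq> 1"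
begin

definition F :: "'b \<times> 'c \<Rightarrow> 'b \<times> 'c" where
  "F = (\<lambda>(z, x). (f z, s (\<iota> z) (\<rho> * h x)))"

definition M :: "('b \<times> 'c) set" where
  "M = (\<lambda>(z, w). (f z, s (\<iota> z) w)) ` (B \<times> unit_circle)"

lemma \<rho>_mult_in: "w \<in> unit_circle \<Longrightarrow> \<rho> * w \<in> unit_circle"
  by (simp add: norm_mult norm_\<rho>)

lemma closed_invariant_eq_Times:
  assumes L: "L \<subseteq> B \<times> unit_circle" "closed L" "L \<noteq> {}"
    and invariant: "\<And>z w. (z, w) \<in> L \<Longrightarrow> (f z, \<rho> * w) \<in> L"
  shows "L = B \<times> unit_circle"
proof (rule antisym[OF L(1)], rule subrelI)
  fix z w assume zw: "(z, w) \<in> B \<times> unit_circle"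
  obtain y v where yv: "(y, v) \<in> L" using L(3) by auto
  then have y: "y \<in> B" and v: "norm v = 1" using L(1) by auto
  have orbit: "((f ^^ n) y, \<rho> ^ n * v) \<in> L" for n
  proof (induction n)
    case (Suc n)
    then show ?case using invariant[OF Suc] by (simp add: mult_ac)
  qed (use yv in simp)
  have "(z, w) \<in> closure L"
    unfolding closure_approachable
  proof (intro allI impI)
    fix e :: real assume "0 < e"
    obtain r q where q: "0 < q" and near_z: "\<And>m. (f ^^ (r + q * m)) y \<in> ball z (e / 2)"
      using visits_periodically[OF y, of z "ball z (e / 2)"] zw \<open>0 < e\<close> by auto
    define u where "u = \<rho> ^ r * v"
    have u: "norm u = 1" "u \<noteq> 0" using v norm_\<rho> by (auto simp: u_def norm_mult norm_power)
    obtain m where m: "dist ((\<rho> ^ q) ^ m) (w / u) < e / 2"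
    proof (rule powers_dense_in_unit_circle[of "\<rho> ^ q" "w / u" "e / 2"])
      show "(\<rho> ^ q) ^ n \<noteq> 1" if "0 < n" for n
        using not_root_of_unity[of "q * n"] q that by (simp add: power_mult)
    qed (use norm_\<rho> zw u \<open>0 < e\<close> in \<open>auto simp: norm_power norm_divide\<close>)
    have "\<rho> ^ (r + q * m) * v = u * (\<rho> ^ q) ^ m"
      by (simp add: u_def power_add power_mult)
    then have "dist (\<rho> ^ (r + q * m) * v) w = norm (u * ((\<rho> ^ q) ^ m - w / u))"
      using u(2) by (simp add: dist_norm right_diff_distrib)
    also have "\<dots> < e / 2" using m u(1) by (simp add: norm_mult dist_norm)
    finally have near_w: "dist (\<rho> ^ (r + q * m) * v) w < e / 2" .
    have "dist ((f ^^ (r + q * m)) y, \<rho> ^ (r + q * m) * v) (z, w)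
        \<le> dist ((f ^^ (r + q * m)) y) z + dist (\<rho> ^ (r + q * m) * v) w"
      unfolding dist_prod_def by (simp add: sqrt_sum_squares_le_sum)
    also have "\<dots> < e" using near_w near_z[of m] by (simp add: dist_commute)
    finally show "\<exists>p\<in>L. dist p (z, w) < e" using orbit by blast
  qed
  then show "(z, w) \<in> L" using L(2) by simp
qed

lemma closed_invariant_eq_B:
  assumes "K \<subseteq> B" "closed K" "K \<noteq> {}" "f ` K \<subseteq> K"
  shows "K = B"
proof -
  have "K \<times> unit_circle = B \<times> unit_circle"
  proof (rule closed_invariant_eq_Times)
    show "closed (K \<times> unit_circle)" using assms(2) by (intro closed_Times closed_sphere)
  qed (use assms \<rho>_mult_in in auto)
  moreover have "unit_circle \<noteq> {}" by simp
  ultimately show ?thesis by (metis Times_eq_cancel2 ex_in_conv)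
qed

lemma minimal_map_f: "minimal_map B f"
  unfolding minimal_map_def
proof (intro conjI allI impI)
  show "K = B" if "K \<subseteq> B \<and> closedin (top_of_set B) K \<and> K \<noteq> {} \<and> f ` K \<subseteq> K" for K
    using that closed_invariant_eq_B closedin_closed_trans compact_imp_closed[OF compact_B] by blast
qed (use continuous_on_f f_in in auto)

lemma f_image: "f ` B = B"
proof (rule closed_invariant_eq_B)
  show "closed (f ` B)"
    using compact_continuous_image[OF continuous_on_f compact_B] by (rule compact_imp_closed)
qed (use f_in b_in in auto)

lemma continuous_on_sections:
  fixes X :: "'z::topological_space set"
  assumes g: "continuous_on X g" "g ` X \<subseteq> unit_circle" and X: "closed X"
  shows "continuous_on (B \<times> X) (\<lambda>(z, x). (f z, s (\<iota> z) (g x)))"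
proof -
  define P where "P k = {z \<in> B. \<iota> z = k}" for k
  have "continuous_on (P k \<times> X) (\<lambda>(z, x). (f z, s (\<iota> z) (g x)))" if k: "k < N" for k
  proof -
    have "continuous_on (P k \<times> X) (\<lambda>p. (f (fst p), s k (g (snd p))))"
      by (intro continuous_on_Pair continuous_on_compose2[OF continuous_on_f]
          continuous_on_compose2[OF continuous_on_section[OF k]] continuous_on_compose2[OF g(1)]
          continuous_on_fst continuous_on_snd continuous_on_id)
         (use g(2) in \<open>auto simp: P_def\<close>)
    then show ?thesis by (rule continuous_on_eq) (auto simp: P_def)
  qed
  moreover have "closed (P k)" for k
    unfolding P_def
    using continuous_on_index compact_imp_closed[OF compact_B]
    by (rule continuous_closed_preimage_constant)
  ultimately have "continuous_on (\<Union>k\<in>{..<N}. P k \<times> X) (\<lambda>(z, x). (f z, s (\<iota> z) (g x)))"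
    by (intro continuous_on_closed_Union closed_Times X) auto
  moreover have "(\<Union>k\<in>{..<N}. P k \<times> X) = B \<times> X" using index_less by (auto simp: P_def)
  ultimately show ?thesis by simp
qed

lemma continuous_on_F: "continuous_on (B \<times> \<Gamma>) F"
  unfolding F_def
proof (rule continuous_on_sections)
  show "continuous_on \<Gamma> (\<lambda>x. \<rho> * h x)" by (intro continuous_intros continuous_on_h)
qed (use h_in \<rho>_mult_in compact_imp_closed[OF compact_\<Gamma>] in auto)

lemma compact_M: "compact M"
  unfolding M_def
  by (intro compact_continuous_image compact_Times compact_B compact_sphere continuous_on_sections)
     auto

lemma M_subset: "M \<subseteq> B \<times> \<Gamma>"
  using f_in section_in index_less by (auto simp: M_def)

lemma F_image_subset: "F ` (B \<times> \<Gamma>) \<subseteq> M"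
proof (rule image_subsetI)
  fix p assume "p \<in> B \<times> \<Gamma>"
  then obtain z x where p: "p = (z, x)" "z \<in> B" "x \<in> \<Gamma>" by auto
  then have "(z, \<rho> * h x) \<in> B \<times> unit_circle" using \<rho>_mult_in h_in by blast
  then show "F p \<in> M" unfolding p(1) F_def M_def by (rule rev_image_eqI) simp
qed

text \<open>The value of \<open>F\<close> at \<open>(z, x)\<close> depends on \<open>(z, h x)\<close> only, and these pairs fill \<open>B \<times> S\<^sup>1\<close>.\<close>

lemma closed_invariant_eq_M:
  assumes K: "K \<subseteq> M" "closed K" "K \<noteq> {}" "F ` K \<subseteq> K"
  shows "K = M"
proof (rule antisym[OF K(1)])
  define \<pi> where "\<pi> = (\<lambda>(z :: 'b, x). (z, h x))"
  have K_sub: "K \<subseteq> B \<times> \<Gamma>" using K(1) M_subset by blast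
  have "\<pi> ` K = B \<times> unit_circle"
  proof (rule closed_invariant_eq_Times)
    show "\<pi> ` K \<subseteq> B \<times> unit_circle" using K_sub h_in by (auto simp: \<pi>_def)
    have "compact K" using compact_M K(1,2) by (metis compact_Int_closed inf.absorb2)
    moreover have "continuous_on K \<pi>"
      unfolding \<pi>_def case_prod_unfold
      by (intro continuous_on_Pair continuous_on_fst continuous_on_snd continuous_on_id
          continuous_on_compose2[OF continuous_on_h]) (use K_sub in auto)
    ultimately show "closed (\<pi> ` K)" by (intro compact_imp_closed compact_continuous_image)
    show "(f z, \<rho> * w) \<in> \<pi> ` K" if zw: "(z, w) \<in> \<pi> ` K" for z w
    proof -
      obtain x where x: "(z, x) \<in> K" "w = h x" using zw by (auto simp: \<pi>_def)
      then have "z \<in> B" "x \<in> \<Gamma>" using K_sub by auto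
      then have "h (s (\<iota> z) (\<rho> * w)) = \<rho> * w"
        unfolding x(2) by (intro h_section index_less \<rho>_mult_in h_in)
      then have "\<pi> (F (z, x)) = (f z, \<rho> * w)" by (simp add: \<pi>_def F_def x(2))
      then show ?thesis using K(4) x(1) by (metis image_eqI subsetD)
    qed
  qed (use K(3) in simp)
  moreover have "\<rho> \<noteq> 0" using norm_\<rho> by auto
  ultimately have "(f z, s (\<iota> z) w) \<in> F ` K" if zw: "z \<in> B" "w \<in> unit_circle" for z w
  proof -
    have "(z, w / \<rho>) \<in> \<pi> ` K"
      using \<open>\<pi> ` K = B \<times> unit_circle\<close> zw norm_\<rho> by (simp add: norm_divide)
    then obtain x where x: "(z, x) \<in> K" "h x = w / \<rho>" by (auto simp: \<pi>_def)
    then have "F (z, x) = (f z, s (\<iota> z) w)" using \<open>\<rho> \<noteq> 0\<close> by (simp add: F_def)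
    then show ?thesis using x(1) by (metis imageI)
  qed
  then show "M \<subseteq> K" using K(4) by (auto simp: M_def)
qed

lemma minimal_set_F: "minimal_set F M"
  unfolding minimal_set_def
proof (intro conjI allI impI)
  show "M \<noteq> {}" using b_in by (auto simp: M_def)
  show "closed M" using compact_M by (rule compact_imp_closed)
  show "F ` M \<subseteq> M" using F_image_subset M_subset by blast
  show "K = M" if "K \<subseteq> M \<and> closedin (top_of_set M) K \<and> K \<noteq> {} \<and> F ` K \<subseteq> K" for K
    using that closed_invariant_eq_M closedin_closed_trans compact_imp_closed[OF compact_M] by blast
qed

lemma fibre_eq: "M \<inter> ({y} \<times> \<Gamma>) = {y} \<times> (\<Union>k\<in>\<iota> ` {z \<in> B. f z = y}. s k ` unit_circle)"
proof (intro antisym subsetI)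
  fix p assume "p \<in> {y} \<times> (\<Union>k\<in>\<iota> ` {z \<in> B. f z = y}. s k ` unit_circle)"
  then obtain z w where "(z, w) \<in> B \<times> unit_circle" and p: "p = (y, s (\<iota> z) w)" "f z = y" by auto
  then have "p \<in> M" unfolding M_def by (intro rev_image_eqI[of "(z, w)"]) auto
  then show "p \<in> M \<inter> ({y} \<times> \<Gamma>)" using M_subset p(1) by auto
qed (auto simp: M_def)

lemma fibre_over_b: "M \<inter> ({b} \<times> \<Gamma>) = {b} \<times> (\<Union>k<N. s k ` unit_circle)"
  unfolding fibre_eq index_fibre ..

lemma circle_fibre:
  assumes "y \<in> B" "y \<noteq> b"
  shows "circle (M \<inter> ({y} \<times> \<Gamma>))"
proof -
  have "y \<in> f ` B" using assms(1) by (simp only: f_image)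
  then obtain z where z: "z \<in> B" "f z = y" by blast
  then have "{z \<in> B. f z = y} = {z}" using inj_off_b assms(2) by auto
  then have "M \<inter> ({y} \<times> \<Gamma>) = (\<lambda>w. (y, s (\<iota> z) w)) ` unit_circle"
    unfolding fibre_eq by auto
  moreover have "circle ((\<lambda>w. (y, s (\<iota> z) w)) ` unit_circle)"
  proof (rule circle_injective_image)
    show "continuous_on unit_circle (\<lambda>w. (y, s (\<iota> z) w))"
      by (intro continuous_intros continuous_on_section index_less z(1))
    show "inj_on (\<lambda>w. (y, s (\<iota> z) w)) unit_circle"
      by (intro inj_onI) (metis h_section index_less prod.inject z(1))
  qed (rule circle_unit_circle)
  ultimately show ?thesis by simp
qed

end

lemma skew_system_of_circle_sections:
  fixes \<Gamma> :: "(real^3) set"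
  assumes \<Gamma>: "is_graph \<Gamma>" "connected \<Gamma>" and "circle_sections \<Gamma> h N s" and "0 < N"
  obtains B f F M b where "skew_system B f \<Gamma> F M b"
    "M \<inter> ({b} \<times> \<Gamma>) = {b} \<times> (\<Union>k<N. s k ` unit_circle)"
proof -
  obtain f b \<iota> where "branched_minimal_system cantor_ternary f b N \<iota>"
    using ex_branched_minimal_system_cantor[OF \<open>0 < N\<close>] .
  then interpret branched_minimal_system cantor_ternary f b N \<iota> .
  interpret circle_sections \<Gamma> h N s by fact
  obtain \<rho> :: complex where "norm \<rho> = 1" "\<And>n. 0 < n \<Longrightarrow> \<rho> ^ n \<noteq> 1"
    using ex_not_root_of_unity by blast
  then interpret skew_product cantor_ternary f b N \<iota> \<Gamma> h s \<rho> by unfold_locales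
  have "skew_system cantor_ternary f \<Gamma> F M b"
    unfolding skew_system_def cantor_set_def
    using \<Gamma> minimal_map_f continuous_on_F F_image_subset M_subset minimal_set_F b_in circle_fibre
    by (auto simp: F_def homeomorphic_refl)
  then show ?thesis using that fibre_over_b by blast
qed

section \<open>Attaching handles to a circle in space\<close>

lemma continuous_on_compact_image_factor:
  fixes g :: "'a::topological_space \<Rightarrow> 'b::t2_space" and f :: "'b \<Rightarrow> 'c::topological_space"
  assumes S: "compact S" and g: "continuous_on S g" and fg: "continuous_on S (\<lambda>x. f (g x))"
  shows "continuous_on (g ` S) f"
  unfolding continuous_on_closed_invariant
proof (intro allI impI)
  fix T :: "'c set" assume "closed T"
  then obtain A where A: "closed A" "A \<inter> S = (\<lambda>x. f (g x)) -` T \<inter> S"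
    using fg unfolding continuous_on_closed_invariant by blast
  have "compact (S \<inter> A)" using S A(1) by (rule compact_Int_closed)
  then have "compact (g ` (S \<inter> A))"
    using g by (metis compact_continuous_image continuous_on_subset inf_le1)
  moreover have "g ` (S \<inter> A) = f -` T \<inter> g ` S" using A(2) by blast
  ultimately show "\<exists>A. closed A \<and> A \<inter> g ` S = f -` T \<inter> g ` S"
    by (intro exI[of _ "g ` (S \<inter> A)"]) (auto intro: compact_imp_closed)
qed

lemma injective_extension_by_compact_piece:
  fixes f :: "'a::t2_space \<Rightarrow> 'b::topological_space" and \<zeta> :: "'k::topological_space \<Rightarrow> 'a"
  assumes X: "closed X" and f: "continuous_on X f" "inj_on f X"
    and K: "compact K" and cont: "continuous_on K \<zeta>" "continuous_on K g"
    and old: "\<And>t. \<lbrakk>t \<in> K; \<zeta> t \<in> X\<rbrakk> \<Longrightarrow> g t = f (\<zeta> t)"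
    and new: "\<And>t. \<lbrakk>t \<in> K; \<zeta> t \<notin> X\<rbrakk> \<Longrightarrow> g t \<notin> f ` X"
    and inj: "\<And>t u. \<lbrakk>t \<in> K; u \<in> K; \<zeta> t \<notin> X; \<zeta> u \<notin> X\<rbrakk> \<Longrightarrow> g t = g u \<longleftrightarrow> \<zeta> t = \<zeta> u"
  obtains \<Psi> where "continuous_on (X \<union> \<zeta> ` K) \<Psi>" "inj_on \<Psi> (X \<union> \<zeta> ` K)"
    "\<forall>x\<in>X. \<Psi> x = f x" "\<forall>t\<in>K. \<Psi> (\<zeta> t) = g t"
proof -
  define \<Psi> where "\<Psi> x = (if x \<in> X then f x else g (inv_into K \<zeta> x))" for x
  have \<Psi>_X: "\<Psi> x = f x" if "x \<in> X" for x using that by (simp add: \<Psi>_def)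
  have \<Psi>_\<zeta>: "\<Psi> (\<zeta> t) = g t" if t: "t \<in> K" for t
  proof (cases "\<zeta> t \<in> X")
    case False
    then show ?thesis
      using inj[of "inv_into K \<zeta> (\<zeta> t)" t] t inv_into_into[of "\<zeta> t" \<zeta> K] f_inv_into_f[of "\<zeta> t" \<zeta> K]
      by (simp add: \<Psi>_def)
  qed (use t old \<Psi>_X in simp)
  show ?thesis
  proof (rule that)
    show "\<forall>x\<in>X. \<Psi> x = f x" "\<forall>t\<in>K. \<Psi> (\<zeta> t) = g t" using \<Psi>_X \<Psi>_\<zeta> by blast+
    show "continuous_on (X \<union> \<zeta> ` K) \<Psi>"
    proof (rule continuous_on_closed_Un[OF X])
      show "closed (\<zeta> ` K)" using K cont(1) by (intro compact_imp_closed compact_continuous_image)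
      show "continuous_on X \<Psi>" using f(1) by (rule continuous_on_eq) (simp add: \<Psi>_X)
      have "continuous_on K (\<lambda>t. \<Psi> (\<zeta> t))"
        using cont(2) by (rule continuous_on_eq) (simp add: \<Psi>_\<zeta>)
      with K cont(1) show "continuous_on (\<zeta> ` K) \<Psi>" by (rule continuous_on_compact_image_factor)
    qed
    have mixed: "\<Psi> x \<noteq> \<Psi> (\<zeta> t)" if "x \<in> X" "t \<in> K" "\<zeta> t \<notin> X" for x t
      using that new[of t] by (metis \<Psi>_X \<Psi>_\<zeta> image_eqI)
    show "inj_on \<Psi> (X \<union> \<zeta> ` K)"
    proof (rule inj_onI)
      fix x y assume xy: "x \<in> X \<union> \<zeta> ` K" "y \<in> X \<union> \<zeta> ` K" and eq: "\<Psi> x = \<Psi> y"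
      show "x = y"
      proof (cases "x \<in> X \<longleftrightarrow> y \<in> X")
        case True
        then show ?thesis
          using xy eq inj by (cases "x \<in> X") (auto simp: \<Psi>_X \<Psi>_\<zeta> dest: inj_onD[OF f(2)])
      next
        case False
        then show ?thesis using xy eq mixed by (metis UnE imageE)
      qed
    qed
  qed
qed

definition point3 :: "complex \<Rightarrow> real \<Rightarrow> real^3" where
  "point3 w t = vector [Re w, Im w, t]"

lemma point3_nth [simp]: "point3 w t $ 1 = Re w" "point3 w t $ 2 = Im w" "point3 w t $ 3 = t"
  by (simp_all add: point3_def)

lemma point3_eq_iff: "point3 w t = point3 w' t' \<longleftrightarrow> w = w' \<and> t = t'"
  by (auto simp: vec_eq_iff forall_3 complex_eq_iff)

lemma continuous_on_point3 [continuous_intros]: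
  fixes f :: "'a::t2_space \<Rightarrow> complex"
  assumes "continuous_on S f" "continuous_on S g"
  shows "continuous_on S (\<lambda>x. point3 (f x) (g x))"
  unfolding continuous_on_componentwise[where f = "\<lambda>x. point3 (f x) (g x)"] Basis_vec_def
  using assms by (auto simp: forall_3 inner_axis intro!: continuous_intros)

definition ring :: "real \<Rightarrow> (real^3) set" where
  "ring c = (\<lambda>w. point3 w c) ` unit_circle"

lemma circle_ring: "circle (ring c)"
  unfolding ring_def
  by (intro circle_injective_image circle_unit_circle)
     (auto simp: inj_on_def point3_eq_iff intro!: continuous_intros)

lemma disjoint_rings: "c \<noteq> d \<Longrightarrow> ring c \<inter> ring d = {}"
  by (auto simp: ring_def point3_eq_iff)

definition direction :: "real^3 \<Rightarrow> complex" where
  "direction x = sgn (Complex (x $ 1) (x $ 2))"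

lemma direction_point3 [simp]: "direction (point3 w t) = sgn w"
  by (simp add: direction_def)

lemma continuous_on_direction:
  assumes "\<And>x. x \<in> S \<Longrightarrow> norm (direction x) = 1"
  shows "continuous_on S direction"
proof -
  have "continuous_on S (\<lambda>x::real^3. Complex (x $ 1) (x $ 2))"
    by (intro continuous_on_Complex continuous_intros)
  moreover have "Complex (x $ 1) (x $ 2) \<noteq> 0" if "x \<in> S" for x
    using assms[OF that] by (auto simp: direction_def)
  ultimately show ?thesis unfolding direction_def by (intro continuous_on_sgn) auto
qed

text \<open>The graph of the distance to \<open>A\<close>, drawn over the unit circle on the cone of slope \<open>k\<close> that
  passes through this circle. Pages with different indices can meet only in the circle.\<close>

definition page :: "nat \<Rightarrow> complex set \<Rightarrow> complex \<Rightarrow> real^3" where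
  "page k A w = point3 (of_real (1 + infdist w A) * w) (real k * infdist w A)"

lemma continuous_on_page: "continuous_on S (page k A)"
  unfolding page_def by (intro continuous_intros)

lemma direction_page:
  assumes "norm w = 1"
  shows "direction (page k A w) = w"
proof -
  have "norm (of_real (1 + infdist w A) * w) = 1 + infdist w A"
    using assms infdist_nonneg[of w A] by (simp only: norm_mult norm_of_real) simp
  then show ?thesis
    using infdist_nonneg[of w A] by (simp add: page_def sgn_eq del: of_real_add)
qed

lemma page_eqD:
  assumes "page k A w = page l A' w'" "norm w = 1" "norm w' = 1"
  shows "w = w'" "k = l \<or> infdist w A = 0"
proof -
  show w: "w = w'" using assms direction_page by metis
  have "of_real (1 + infdist w A) * w = of_real (1 + infdist w' A') * w'"
    and height: "real k * infdist w A = real l * infdist w' A'"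
    using assms(1) by (simp_all add: page_def point3_eq_iff)
  moreover have "w \<noteq> 0" using assms(2) by auto
  ultimately have "complex_of_real (1 + infdist w A) = of_real (1 + infdist w' A')" using w by simp
  then have "infdist w A = infdist w' A'" by (simp only: of_real_eq_iff)
  then show "k = l \<or> infdist w A = 0" using height by auto
qed

lemma page_in: "w \<in> A \<Longrightarrow> page k A w = point3 w 0"
  by (simp add: page_def)

definition pages :: "(nat \<Rightarrow> complex set) \<Rightarrow> nat \<Rightarrow> (real^3) set" where
  "pages A N = (\<Union>k<N. page k (A k) ` unit_circle)"

lemma pages_upd_Suc: "pages (A(N := D)) (Suc N) = pages A N \<union> page N D ` unit_circle"
  by (auto simp: pages_def lessThan_Suc)

lemma page_notin_pages:
  assumes "norm w = 1" "w \<notin> D" "closed D" "D \<noteq> {}"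
  shows "page N D w \<notin> pages A N"
proof
  assume "page N D w \<in> pages A N"
  then obtain k v where "k < N" "norm v = 1" "page N D w = page k (A k) v" by (auto simp: pages_def)
  then have "infdist w D = 0" using page_eqD(2) assms(1) by blast
  then show False using assms(2-) in_closed_iff_infdist_zero by blast
qed

lemma circle_sections_pages:
  assumes "compact (pages A N)"
  shows "circle_sections (pages A N) direction N (\<lambda>k. page k (A k))"
proof
  show "direction x \<in> unit_circle" if "x \<in> pages A N" for x
    using that by (auto simp: pages_def direction_page)
  then show "continuous_on (pages A N) direction" by (intro continuous_on_direction) auto
  show "page k (A k) w \<in> pages A N" if "k < N" "w \<in> unit_circle" for k w
    using that unfolding pages_def by blast
qed (use assms in \<open>auto simp: direction_page continuous_on_page\<close>)

lemma simple_loop_minus_initial_arc: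
  assumes "simple_path \<gamma>" "pathfinish \<gamma> = pathstart \<gamma>" "0 < r" "r \<le> 1"
  shows "path_image \<gamma> - \<gamma> ` {0<..<r} = \<gamma> ` {r..1}"
proof (intro antisym subsetI)
  fix x assume x: "x \<in> path_image \<gamma> - \<gamma> ` {0<..<r}"
  then obtain t where t: "t \<in> {0..1}" "x = \<gamma> t" by (auto simp: path_image_def)
  moreover have "t \<notin> {0<..<r}" using x t(2) by blast
  moreover have "\<gamma> 1 = \<gamma> 0" using assms(2) by (simp add: pathstart_def pathfinish_def)
  ultimately show "x \<in> \<gamma> ` {r..1}"
    using assms(4) by (cases "t = 0") (auto intro: image_eqI[of _ _ 1])
next
  fix x assume "x \<in> \<gamma> ` {r..1}"
  then obtain t where t: "r \<le> t" "t \<le> 1" "x = \<gamma> t" by auto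
  have "loop_free \<gamma>" using assms(1) by (simp add: simple_path_def)
  then have "\<gamma> s \<noteq> x" if "s \<in> {0<..<r}" for s
    using that t assms(3,4) loop_freeD[of \<gamma> s t] by auto
  then have "x \<notin> \<gamma> ` {0<..<r}" by blast
  moreover have "x \<in> path_image \<gamma>" using t assms(3) by (auto simp: path_image_def)
  ultimately show "x \<in> path_image \<gamma> - \<gamma> ` {0<..<r}" by blast
qed

lemma ex_affine_interval_map:
  fixes u v r :: real
  assumes "u < v" "0 < r"
  obtains \<sigma> where "continuous_on {u..v} \<sigma>" "inj \<sigma>" "\<sigma> u = 0" "\<sigma> v = r"
    "\<sigma> ` {u..v} = {0..r}" "\<sigma> ` {u<..<v} = {0<..<r}"
proof -
  define m where "m = r / (v - u)"
  define \<sigma> where "\<sigma> t = m * t - m * u" for t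
  have "0 < m" "m * (v - u) = r" using assms by (simp_all add: m_def)
  then have m: "0 < m" "m * v - m * u = r" by (simp_all add: right_diff_distrib)
  have ends: "\<sigma> u = 0" "\<sigma> v = r" using m(2) by (simp_all add: \<sigma>_def)
  have inj: "inj \<sigma>" using m(1) by (simp add: inj_def \<sigma>_def)
  have closed_image: "\<sigma> ` {u..v} = {0..r}"
    unfolding \<sigma>_def using m assms(1) by (simp add: image_affinity_atLeastAtMost_diff)
  have "\<sigma> ` ({u..v} - {u, v}) = {0..r} - {0, r}"
    unfolding image_set_diff[OF inj] using closed_image ends by simp
  then have "\<sigma> ` {u<..<v} = {0<..<r}" by (simp add: atLeastAtMost_diff_ends)
  moreover have "continuous_on {u..v} \<sigma>" unfolding \<sigma>_def by (intro continuous_intros)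
  ultimately show ?thesis using that inj ends closed_image by blast
qed

lemma circle_arc_between:
  fixes C :: "'a::t2_space set" and u v :: real
  assumes C: "circle C" and p: "p \<in> C" and q: "q \<in> C" and "u < v"
  obtains e where "continuous_on {u..v} e" "e ` {u..v} \<subseteq> C" "e u = p" "e v = q"
    "inj_on e {u<..<v}" "closed (C - e ` {u<..<v})" "p \<notin> e ` {u<..<v}" "q \<notin> e ` {u<..<v}"
proof -
  obtain \<gamma> where \<gamma>: "simple_path \<gamma>" "path_image \<gamma> = C" "pathstart \<gamma> = p" "pathfinish \<gamma> = p"
    using circle_simple_path[OF C p] .
  have ends: "\<gamma> 0 = p" "\<gamma> 1 = p" using \<gamma>(3,4) by (simp_all add: pathstart_def pathfinish_def)
  have cont: "continuous_on {0..1} \<gamma>" using \<gamma>(1) by (simp add: simple_path_def path_def)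
  obtain r where r: "0 < r" "r \<le> 1" "\<gamma> r = q"
  proof -
    obtain t where "0 \<le> t" "t \<le> 1" "\<gamma> t = q" using q \<gamma>(2) by (auto simp: path_image_def)
    then show thesis using that[of t] that[of 1] ends by (cases "t = 0") auto
  qed
  have rest: "C - \<gamma> ` {0<..<r} = \<gamma> ` {r..1}"
    using simple_loop_minus_initial_arc[OF \<gamma>(1) _ r(1,2)] \<gamma>(2-4) by simp
  obtain \<sigma> where \<sigma>: "continuous_on {u..v} \<sigma>" "inj \<sigma>" "\<sigma> u = 0" "\<sigma> v = r"
    "\<sigma> ` {u..v} = {0..r}" "\<sigma> ` {u<..<v} = {0<..<r}"
    by (rule ex_affine_interval_map[OF \<open>u < v\<close> r(1)])
  show ?thesis
  proof (rule that[of "\<gamma> \<circ> \<sigma>"])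
    have "{0..r} \<subseteq> {0..1}" "{0<..<r} \<subseteq> {0<..<1}" using r(2) by auto
    then show "continuous_on {u..v} (\<gamma> \<circ> \<sigma>)" "(\<gamma> \<circ> \<sigma>) ` {u..v} \<subseteq> C" "inj_on (\<gamma> \<circ> \<sigma>) {u<..<v}"
      using cont \<sigma>(1,2,5,6) \<gamma>(2) simple_path_inj_on[OF \<gamma>(1)] unfolding path_image_def
      by (metis continuous_on_compose continuous_on_subset, metis image_comp image_mono,
          metis comp_inj_on inj_on_subset subset_UNIV)
    show "(\<gamma> \<circ> \<sigma>) u = p" "(\<gamma> \<circ> \<sigma>) v = q" using ends r(3) \<sigma>(3,4) by simp_all
    have image: "(\<gamma> \<circ> \<sigma>) ` {u<..<v} = \<gamma> ` {0<..<r}" by (metis \<sigma>(6) image_comp)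
    have "compact (\<gamma> ` {r..1})"
      using r(1) by (intro compact_continuous_image continuous_on_subset[OF cont]) auto
    then show "closed (C - (\<gamma> \<circ> \<sigma>) ` {u<..<v})" unfolding image rest by (rule compact_imp_closed)
    have "p \<in> \<gamma> ` {r..1}" using ends(2) r(2) by (intro image_eqI[of _ _ 1]) auto
    moreover have "q \<in> \<gamma> ` {r..1}" using r by (intro image_eqI[of _ _ r]) auto
    ultimately show "p \<notin> (\<gamma> \<circ> \<sigma>) ` {u<..<v}" "q \<notin> (\<gamma> \<circ> \<sigma>) ` {u<..<v}"
      unfolding image using rest by blast+
  qed
qed

lemma page_over_arc:
  fixes u v :: real
  assumes pq: "p \<in> unit_circle" "q \<in> unit_circle" and "u < v"
  obtains g D where "continuous_on {u..v} g" "g u = point3 p 0" "g v = point3 q 0"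
    "inj_on g {u<..<v}" "\<And>A. g ` {u<..<v} \<inter> pages A N = {}"
    "g ` {u..v} \<subseteq> page N D ` unit_circle" "page N D ` unit_circle \<subseteq> ring 0 \<union> g ` {u..v}"
proof -
  obtain e where e: "continuous_on {u..v} e" "e ` {u..v} \<subseteq> unit_circle" "e u = p" "e v = q"
    "inj_on e {u<..<v}" "closed (unit_circle - e ` {u<..<v})" "p \<notin> e ` {u<..<v}" "q \<notin> e ` {u<..<v}"
    using circle_unit_circle pq \<open>u < v\<close> by (rule circle_arc_between)
  define D where "D = unit_circle - e ` {u<..<v}"
  have D: "closed D" "p \<in> D" "q \<in> D" using e(6-8) pq unfolding D_def by auto
  have norm_e: "norm (e t) = 1" if "t \<in> {u..v}" for t
    using e(2) that by (metis image_subset_iff mem_sphere_0)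
  show ?thesis
  proof (rule that[of "page N D \<circ> e" D])
    show "continuous_on {u..v} (page N D \<circ> e)"
      by (rule continuous_on_compose[OF e(1) continuous_on_page])
    show "(page N D \<circ> e) u = point3 p 0" "(page N D \<circ> e) v = point3 q 0"
      using e(3,4) D page_in by simp_all
    have "inj_on (page N D) (e ` {u<..<v})"
      by (intro inj_onI page_eqD(1)) (auto simp: norm_e)
    then show "inj_on (page N D \<circ> e) {u<..<v}" using e(5) by (intro comp_inj_on)
    have "page N D (e t) \<notin> pages A N" if "t \<in> {u<..<v}" for t A
      using that D norm_e by (intro page_notin_pages) (auto simp: D_def)
    then show "(page N D \<circ> e) ` {u<..<v} \<inter> pages A N = {}" for A by auto
    show "(page N D \<circ> e) ` {u..v} \<subseteq> page N D ` unit_circle"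
      unfolding image_comp[symmetric] by (rule image_mono[OF e(2)])
    have "page N D w \<in> ring 0" if "w \<in> D" for w
      using that page_in[OF that] by (auto simp: ring_def D_def)
    moreover have "unit_circle \<subseteq> D \<union> e ` {u..v}" by (auto simp: D_def)
    ultimately show "page N D ` unit_circle \<subseteq> ring 0 \<union> (page N D \<circ> e) ` {u..v}"
      unfolding image_comp[symmetric] by blast
  qed
qed

lemma attach_handle:
  fixes X :: "'a::t2_space set" and \<zeta> :: "real \<Rightarrow> 'a"
  assumes X: "closed X" and \<Phi>: "continuous_on X \<Phi>" "inj_on \<Phi> X" "\<Phi> ` X = pages A N"
    and "ring 0 \<subseteq> pages A N"
    and \<zeta>: "u < v" "continuous_on {u..v} \<zeta>" "inj_on \<zeta> {u<..<v}" "\<zeta> ` {u<..<v} \<inter> X = {}"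
    and ends: "\<zeta> u \<in> X" "\<zeta> v \<in> X" "\<Phi> (\<zeta> u) \<in> ring 0" "\<Phi> (\<zeta> v) \<in> ring 0"
  obtains \<Psi> D where "continuous_on (X \<union> \<zeta> ` {u..v}) \<Psi>" "inj_on \<Psi> (X \<union> \<zeta> ` {u..v})"
    "\<Psi> ` (X \<union> \<zeta> ` {u..v}) = pages (A(N := D)) (Suc N)" "\<forall>x\<in>X. \<Psi> x = \<Phi> x"
proof -
  obtain p q where pq: "p \<in> unit_circle" "q \<in> unit_circle"
    and \<Phi>_ends: "\<Phi> (\<zeta> u) = point3 p 0" "\<Phi> (\<zeta> v) = point3 q 0"
    using ends(3,4) unfolding ring_def by blast
  obtain g D where g: "continuous_on {u..v} g" "g u = point3 p 0" "g v = point3 q 0"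
    "inj_on g {u<..<v}" "\<And>A. g ` {u<..<v} \<inter> pages A N = {}"
    "g ` {u..v} \<subseteq> page N D ` unit_circle" "page N D ` unit_circle \<subseteq> ring 0 \<union> g ` {u..v}"
    using page_over_arc[OF pq \<zeta>(1)] by metis
  have interior: "t \<in> {u<..<v}" if "t \<in> {u..v}" "\<zeta> t \<notin> X" for t
    using that ends by (cases "t = u"; cases "t = v") auto
  obtain \<Psi> where \<Psi>: "continuous_on (X \<union> \<zeta> ` {u..v}) \<Psi>" "inj_on \<Psi> (X \<union> \<zeta> ` {u..v})"
    "\<forall>x\<in>X. \<Psi> x = \<Phi> x" "\<forall>t\<in>{u..v}. \<Psi> (\<zeta> t) = g t"
  proof (rule injective_extension_by_compact_piece[OF X \<Phi>(1,2) compact_Icc \<zeta>(2) g(1)])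
    fix t assume t: "t \<in> {u..v}"
    show "g t = \<Phi> (\<zeta> t)" if "\<zeta> t \<in> X"
    proof -
      have "t \<notin> {u<..<v}" using that \<zeta>(4) by blast
      then have "t = u \<or> t = v" using t by auto
      then show ?thesis using g(2,3) \<Phi>_ends by auto
    qed
    show "g t \<notin> \<Phi> ` X" if "\<zeta> t \<notin> X" unfolding \<Phi>(3) using g(5) interior[OF t that] by blast
    show "g t = g s \<longleftrightarrow> \<zeta> t = \<zeta> s" if "s \<in> {u..v}" "\<zeta> t \<notin> X" "\<zeta> s \<notin> X" for s
      using interior[OF t that(2)] interior[OF that(1,3)]
        inj_on_eq_iff[OF g(4)] inj_on_eq_iff[OF \<zeta>(3)] by metis
  qed
  have "\<Psi> ` (X \<union> \<zeta> ` {u..v}) = pages A N \<union> g ` {u..v}"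
    using \<Psi>(3,4) \<Phi>(3) by (auto simp: image_Un image_image)
  also have "\<dots> = pages A N \<union> page N D ` unit_circle"
    using g(6,7) \<open>ring 0 \<subseteq> pages A N\<close> by blast
  finally show ?thesis using that \<Psi>(1-3) unfolding pages_upd_Suc by blast
qed

definition handles :: "'a::topological_space set \<Rightarrow> (real \<Rightarrow> 'a) \<Rightarrow> (real \<times> real) set \<Rightarrow> bool" where
  "handles C \<zeta> \<U> \<longleftrightarrow>
     (\<forall>u v. (u, v) \<in> \<U> \<longrightarrow> u < v \<and> continuous_on {u..v} \<zeta> \<and> inj_on \<zeta> {u<..<v} \<and>
        \<zeta> u \<in> C \<and> \<zeta> v \<in> C \<and> \<zeta> ` {u<..<v} \<inter> C = {}) \<and>
     (\<forall>u v u' v'. (u, v) \<in> \<U> \<longrightarrow> (u', v') \<in> \<U> \<longrightarrow> (u, v) \<noteq> (u', v') \<longrightarrow>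
        \<zeta> ` {u<..<v} \<inter> \<zeta> ` {u'<..<v'} = {})"

definition with_handles :: "'a set \<Rightarrow> (real \<Rightarrow> 'a) \<Rightarrow> (real \<times> real) set \<Rightarrow> 'a set" where
  "with_handles C \<zeta> \<U> = C \<union> (\<Union>(u, v)\<in>\<U>. \<zeta> ` {u..v})"

lemma with_handles_insert: "with_handles C \<zeta> (insert (u, v) \<U>) = with_handles C \<zeta> \<U> \<union> \<zeta> ` {u..v}"
  by (auto simp: with_handles_def)

lemma compact_with_handles:
  assumes "compact C" "finite \<U>" "handles C \<zeta> \<U>"
  shows "compact (with_handles C \<zeta> \<U>)"
  unfolding with_handles_def using assms
  by (intro compact_Un compact_UN) (auto simp: handles_def intro!: compact_continuous_image)

lemma handle_disjoint_with_handles: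
  assumes "handles C \<zeta> (insert (u, v) \<U>)" "(u, v) \<notin> \<U>"
  shows "\<zeta> ` {u<..<v} \<inter> with_handles C \<zeta> \<U> = {}"
proof -
  have "\<zeta> ` {u<..<v} \<inter> \<zeta> ` {u'..v'} = {}" if U: "(u', v') \<in> \<U>" for u' v'
  proof -
    have "(u, v) \<noteq> (u', v')" using assms(2) U by blast
    then have "\<zeta> ` {u<..<v} \<inter> \<zeta> ` {u'<..<v'} = {}"
      using assms(1) U unfolding handles_def by blast
    moreover have "\<zeta> ` {u<..<v} \<inter> C = {}" "\<zeta> u' \<in> C" "\<zeta> v' \<in> C" "u' < v'"
      using assms(1) U by (auto simp: handles_def)
    moreover have "{u'..v'} = insert u' (insert v' {u'<..<v'})" using \<open>u' < v'\<close> by auto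
    ultimately show ?thesis by auto
  qed
  moreover have "\<zeta> ` {u<..<v} \<inter> C = {}" using assms(1) by (auto simp: handles_def)
  ultimately show ?thesis unfolding with_handles_def by fast
qed

lemma embed_circle_with_handles:
  fixes C :: "'a::t2_space set"
  assumes C: "compact C" and \<eta>: "continuous_on C \<eta>" "inj_on \<eta> C" "\<eta> ` C = unit_circle"
    and "finite \<U>" "handles C \<zeta> \<U>"
  shows "\<exists>A N \<Phi>. 0 < N \<and> continuous_on (with_handles C \<zeta> \<U>) \<Phi> \<and> inj_on \<Phi> (with_handles C \<zeta> \<U>) \<and>
      \<Phi> ` with_handles C \<zeta> \<U> = pages A N \<and> (\<forall>x\<in>C. \<Phi> x = point3 (\<eta> x) 0)"
  using \<open>finite \<U>\<close> \<open>handles C \<zeta> \<U>\<close>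
proof (induction \<U> rule: finite_induct)
  case empty
  have "(\<lambda>x. point3 (\<eta> x) 0) ` C = pages (\<lambda>_. {}) 1"
    unfolding pages_def \<eta>(3)[symmetric] by (simp add: image_image page_def infdist_def lessThan_Suc)
  moreover have "continuous_on C (\<lambda>x. point3 (\<eta> x) 0)" by (intro continuous_intros \<eta>(1))
  moreover have "inj_on (\<lambda>x. point3 (\<eta> x) 0) C" using \<eta>(2) by (simp add: inj_on_def point3_eq_iff)
  ultimately show ?case
    by (intro exI[of _ "\<lambda>_. {}"] exI[of _ 1] exI[of _ "\<lambda>x. point3 (\<eta> x) 0"])
       (simp add: with_handles_def)
next
  case (insert I \<U>)
  obtain u v where I: "I = (u, v)" by (cases I)
  let ?X = "with_handles C \<zeta> \<U>"
  have "handles C \<zeta> \<U>" using insert.prems by (auto simp: handles_def)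
  then obtain A N \<Phi> where "0 < N" and \<Phi>: "continuous_on ?X \<Phi>" "inj_on \<Phi> ?X" "\<Phi> ` ?X = pages A N"
    and \<Phi>_C: "\<And>x. x \<in> C \<Longrightarrow> \<Phi> x = point3 (\<eta> x) 0"
    using insert.IH by blast
  have "C \<subseteq> ?X" by (simp add: with_handles_def)
  have "\<Phi> ` C = ring 0"
    unfolding ring_def \<eta>(3)[symmetric] image_image by (rule image_cong) (simp_all add: \<Phi>_C)
  have handle: "u < v" "continuous_on {u..v} \<zeta>" "inj_on \<zeta> {u<..<v}" "\<zeta> u \<in> C" "\<zeta> v \<in> C"
    using insert.prems unfolding I by (auto simp: handles_def)
  obtain \<Psi> D where "continuous_on (?X \<union> \<zeta> ` {u..v}) \<Psi>" "inj_on \<Psi> (?X \<union> \<zeta> ` {u..v})"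
    "\<Psi> ` (?X \<union> \<zeta> ` {u..v}) = pages (A(N := D)) (Suc N)" and \<Psi>: "\<forall>x\<in>?X. \<Psi> x = \<Phi> x"
  proof (rule attach_handle[OF _ \<Phi> _ handle(1-3)])
    show "closed ?X"
      using compact_with_handles[OF C insert.hyps(1) \<open>handles C \<zeta> \<U>\<close>] by (rule compact_imp_closed)
    show "ring 0 \<subseteq> pages A N" using \<open>\<Phi> ` C = ring 0\<close> \<open>C \<subseteq> ?X\<close> \<Phi>(3) by (metis image_mono)
    show "\<zeta> ` {u<..<v} \<inter> ?X = {}"
      using handle_disjoint_with_handles insert.prems insert.hyps(2) unfolding I by blast
  qed (use handle \<open>C \<subseteq> ?X\<close> \<open>\<Phi> ` C = ring 0\<close> in auto)
  moreover have "\<forall>x\<in>C. \<Psi> x = point3 (\<eta> x) 0" using \<Psi> \<Phi>_C \<open>C \<subseteq> ?X\<close> by auto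
  ultimately show ?case unfolding I with_handles_insert by blast
qed

definition gaps :: "'a::linorder set \<Rightarrow> ('a \<times> 'a) set" where
  "gaps Q = {(u, v). u \<in> Q \<and> v \<in> Q \<and> u < v \<and> {u<..<v} \<inter> Q = {}}"

lemma gaps_disjoint:
  assumes "(u, v) \<in> gaps Q" "(u', v') \<in> gaps Q" "(u, v) \<noteq> (u', v')"
  shows "{u<..<v} \<inter> {u'<..<v'} = {}"
proof -
  have gap: "w \<le> u \<or> v \<le> w" "w' \<le> u' \<or> v' \<le> w'" if "w \<in> Q" "w' \<in> Q" for w w'
    using assms(1,2) that unfolding gaps_def by (auto simp: not_le[symmetric] disjoint_iff)
  have "u \<in> Q" "v \<in> Q" "u' \<in> Q" "v' \<in> Q" using assms(1,2) by (auto simp: gaps_def)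
  then have "v \<le> u' \<or> v' \<le> u" using gap assms(3) by (metis order.antisym order.trans linear)
  then show ?thesis by auto
qed

lemma gap_around:
  fixes Q :: "real set"
  assumes "closed Q" "a \<in> Q" "b \<in> Q" "a \<le> t" "t \<le> b" "t \<notin> Q"
  obtains u v where "(u, v) \<in> gaps Q" "u < t" "t < v"
proof -
  have "compact (Q \<inter> {a..t})" "compact (Q \<inter> {t..b})"
    using assms(1) by (auto intro: closed_Int_compact)
  moreover have "a \<in> Q \<inter> {a..t}" "b \<in> Q \<inter> {t..b}" using assms by auto
  ultimately obtain u v where u: "u \<in> Q \<inter> {a..t}" "\<And>x. x \<in> Q \<inter> {a..t} \<Longrightarrow> x \<le> u"
    and v: "v \<in> Q \<inter> {t..b}" "\<And>x. x \<in> Q \<inter> {t..b} \<Longrightarrow> v \<le> x"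
    using compact_attains_sup[of "Q \<inter> {a..t}"] compact_attains_inf[of "Q \<inter> {t..b}"]
    by (metis empty_iff)
  have "u \<noteq> t" "v \<noteq> t" using u(1) v(1) assms(6) by auto
  then have "u < t" "t < v" using u(1) v(1) by auto
  have "x \<notin> Q" if "u < x" "x < v" for x
    using that u(1) v(1) u(2)[of x] v(2)[of x] by (cases "x \<le> t") auto
  then have "{u<..<v} \<inter> Q = {}" by auto
  then have "(u, v) \<in> gaps Q" using u(1) v(1) \<open>u < t\<close> \<open>t < v\<close> by (simp add: gaps_def)
  then show ?thesis using that \<open>u < t\<close> \<open>t < v\<close> by blast
qed

definition hitting_times :: "(real \<Rightarrow> 'a) \<Rightarrow> 'a set \<Rightarrow> real set" where
  "hitting_times \<zeta> C = {t \<in> {0..1}. \<zeta> t \<in> C}"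

lemma closed_hitting_times:
  assumes "path \<zeta>" "closed C"
  shows "closed (hitting_times \<zeta> C)"
proof -
  have "closed ({0..1} \<inter> \<zeta> -` C)"
    using assms by (intro continuous_closed_preimage) (auto simp: path_def)
  moreover have "{0..1} \<inter> \<zeta> -` C = hitting_times \<zeta> C" by (auto simp: hitting_times_def)
  ultimately show ?thesis by simp
qed

lemma gap_of_hitting_times:
  assumes "(u, v) \<in> gaps (hitting_times \<zeta> C)"
  shows "u < v" "{u..v} \<subseteq> {0..1}" "{u<..<v} \<subseteq> {0<..<1}" "\<zeta> u \<in> C" "\<zeta> v \<in> C"
    "\<zeta> ` {u<..<v} \<inter> C = {}"
  using assms by (auto simp: gaps_def hitting_times_def)

lemma gap_start_notin_open_part:
  assumes \<zeta>: "path \<zeta>" "path_image \<zeta> \<subseteq> G" and uv: "(u, v) \<in> gaps (hitting_times \<zeta> C)"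
    and part: "openin (top_of_set G) P" "P \<subseteq> C"
  shows "\<zeta> u \<notin> P"
proof
  assume "\<zeta> u \<in> P"
  obtain W where W: "open W" "P = G \<inter> W" using part(1) by (auto simp: openin_open)
  note gap = gap_of_hitting_times[OF uv]
  have "(\<zeta> \<longlongrightarrow> \<zeta> u) (at_right u)"
    using \<zeta>(1) gap(1,2) unfolding path_def
    by (intro continuous_on_Icc_at_rightD[of u v]) (auto intro: continuous_on_subset)
  then have "\<forall>\<^sub>F t in at_right u. \<zeta> t \<in> W"
    using topological_tendstoD W \<open>\<zeta> u \<in> P\<close> by blast
  moreover have "\<forall>\<^sub>F t in at_right u. t \<in> {u<..<v}" using gap(1) by (rule eventually_at_right_real)
  ultimately have "\<forall>\<^sub>F t in at_right u. \<zeta> t \<in> W \<and> t \<in> {u<..<v}" by (rule eventually_conj)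
  then obtain t where t: "\<zeta> t \<in> W" "t \<in> {u<..<v}"
    using eventually_happens trivial_limit_at_right_real by blast
  then have "t \<in> {0..1}" using gap(2) by auto
  then have "\<zeta> t \<in> G" using \<zeta>(2) by (auto simp: path_image_def)
  then have "\<zeta> t \<in> C" using t(1) W(2) part(2) by blast
  then show False using t(2) gap(6) by blast
qed

lemma inj_on_gap_starts:
  assumes "simple_path \<zeta>"
  shows "inj_on (\<lambda>(u, v). \<zeta> u) (gaps (hitting_times \<zeta> C))"
proof (rule inj_onI, clarify)
  fix u v u' v'
  assume uv: "(u, v) \<in> gaps (hitting_times \<zeta> C)" "(u', v') \<in> gaps (hitting_times \<zeta> C)"
    and "\<zeta> u = \<zeta> u'"
  note gap = gap_of_hitting_times(1,2)[OF uv(1)] gap_of_hitting_times(1,2)[OF uv(2)]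
  then have "u \<in> {0..<1}" "u' \<in> {0..<1}" by auto
  then have "u = u'"
    using \<open>\<zeta> u = \<zeta> u'\<close> loop_freeD[of \<zeta> u u'] assms by (auto simp: simple_path_def)
  then have "{u<..<v} \<inter> {u'<..<v'} \<noteq> {}" using gap(1,3) by simp
  then show "u = u' \<and> v = v'" using gaps_disjoint[OF uv] by blast
qed

lemma finite_gaps_of_circle:
  assumes "is_graph G" "circle C" "C \<subseteq> G" and \<zeta>: "simple_path \<zeta>" "path_image \<zeta> \<subseteq> G"
  shows "finite (gaps (hitting_times \<zeta> C))"
proof -
  obtain V where V: "finite V" "openin (top_of_set G) (C - V)"
    using circle_openin_minus_finite[OF assms(1-3)] .
  have "\<zeta> u \<in> V" if "(u, v) \<in> gaps (hitting_times \<zeta> C)" for u v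
    using gap_start_notin_open_part[OF simple_path_imp_path[OF \<zeta>(1)] \<zeta>(2) that V(2)]
      gap_of_hitting_times(4)[OF that] by blast
  then have "(\<lambda>(u, v). \<zeta> u) ` gaps (hitting_times \<zeta> C) \<subseteq> V" by auto
  then have "finite ((\<lambda>(u, v). \<zeta> u) ` gaps (hitting_times \<zeta> C))" using V(1) by (rule finite_subset)
  then show ?thesis using inj_on_gap_starts[OF \<zeta>(1)] by (rule finite_imageD)
qed

lemma handles_gaps:
  assumes \<zeta>: "simple_path \<zeta>"
  shows "handles C \<zeta> (gaps (hitting_times \<zeta> C))"
proof -
  let ?gaps = "gaps (hitting_times \<zeta> C)"
  have cont: "continuous_on {0..1} \<zeta>" using \<zeta> by (simp add: simple_path_def path_def)
  have inj: "inj_on \<zeta> {0<..<1}" using \<zeta> by (rule simple_path_inj_on)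
  note gap = gap_of_hitting_times
  have "continuous_on {u..v} \<zeta>" "inj_on \<zeta> {u<..<v}" if "(u, v) \<in> ?gaps" for u v
    using gap(2,3)[OF that] continuous_on_subset[OF cont] inj_on_subset[OF inj] by blast+
  moreover have "\<zeta> ` {u<..<v} \<inter> \<zeta> ` {u'<..<v'} = {}"
    if uv: "(u, v) \<in> ?gaps" "(u', v') \<in> ?gaps" "(u, v) \<noteq> (u', v')" for u v u' v'
    using gaps_disjoint[OF uv] inj_on_image_Int[OF inj gap(3)[OF uv(1)] gap(3)[OF uv(2)]] by simp
  ultimately show ?thesis
    unfolding handles_def using gap[of _ _ \<zeta> C] by (intro conjI allI impI) simp_all
qed

lemma with_handles_gaps:
  assumes \<zeta>: "path \<zeta>" "pathstart \<zeta> \<in> C" "pathfinish \<zeta> \<in> C" and "closed C"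
  shows "with_handles C \<zeta> (gaps (hitting_times \<zeta> C)) = C \<union> path_image \<zeta>" (is "?X = _")
proof (intro antisym Un_least)
  show "?X \<subseteq> C \<union> path_image \<zeta>"
    using gap_of_hitting_times(2) unfolding with_handles_def path_image_def by blast
  have ends: "0 \<in> hitting_times \<zeta> C" "1 \<in> hitting_times \<zeta> C"
    using \<zeta>(2,3) by (auto simp: hitting_times_def pathstart_def pathfinish_def)
  show "path_image \<zeta> \<subseteq> ?X"
  proof
    fix x assume "x \<in> path_image \<zeta>"
    then obtain t where t: "t \<in> {0..1}" "x = \<zeta> t" by (auto simp: path_image_def)
    show "x \<in> ?X"
    proof (cases "\<zeta> t \<in> C")
      case False
      then have "t \<notin> hitting_times \<zeta> C" by (simp add: hitting_times_def)
      then obtain u v where "(u, v) \<in> gaps (hitting_times \<zeta> C)" "u < t" "t < v"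
        using gap_around[OF closed_hitting_times[OF \<zeta>(1) \<open>closed C\<close>] ends] t(1) by auto
      then show ?thesis unfolding with_handles_def t(2) by force
    qed (use t in \<open>simp add: with_handles_def\<close>)
  qed
qed (simp add: with_handles_def)

lemma Un_circles_eq_with_handles:
  assumes "is_graph G" and C: "circle C1" "C1 \<subseteq> G" "circle C2" "C2 \<subseteq> G" and "C1 \<inter> C2 \<noteq> {}"
  obtains \<zeta> \<U> where "finite \<U>" "handles C1 \<zeta> \<U>" "with_handles C1 \<zeta> \<U> = C1 \<union> C2"
proof -
  obtain a where a: "a \<in> C1" "a \<in> C2" using \<open>C1 \<inter> C2 \<noteq> {}\<close> by blast
  obtain \<zeta> where \<zeta>: "simple_path \<zeta>" "path_image \<zeta> = C2" "pathstart \<zeta> = a" "pathfinish \<zeta> = a"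
    using circle_simple_path[OF C(3) a(2)] .
  have "closed C1" using compact_circle[OF C(1)] by (rule compact_imp_closed)
  then have "with_handles C1 \<zeta> (gaps (hitting_times \<zeta> C1)) = C1 \<union> C2"
    using with_handles_gaps[OF simple_path_imp_path[OF \<zeta>(1)], of C1] \<zeta>(2-4) a(1) by simp
  moreover have "finite (gaps (hitting_times \<zeta> C1))"
    using finite_gaps_of_circle[OF assms(1) C(1,2) \<zeta>(1)] \<zeta>(2) C(4) by simp
  ultimately show ?thesis using that handles_gaps[OF \<zeta>(1)] by blast
qed

section \<open>Realising two circles\<close>

definition occurs_as_fibre :: "'a::topological_space set \<Rightarrow> bool" where
  "occurs_as_fibre X \<longleftrightarrow> (\<exists>B f \<Gamma> F M b \<psi>. skew_system B f \<Gamma> F M b \<and>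
     continuous_on X \<psi> \<and> inj_on \<psi> X \<and> M \<inter> ({b} \<times> \<Gamma>) = \<psi> ` X)"

lemma occurs_as_fibre_of_circle_sections:
  fixes \<Phi> :: "'a::topological_space \<Rightarrow> real^3"
  assumes \<Gamma>: "is_graph \<Gamma>" "connected \<Gamma>" "circle_sections \<Gamma> h N s" "0 < N"
    and \<Phi>: "continuous_on X \<Phi>" "inj_on \<Phi> X" "\<Phi> ` X = (\<Union>k<N. s k ` unit_circle)"
  shows "occurs_as_fibre X"
proof -
  obtain B f F M b where system: "skew_system B f \<Gamma> F M b"
    and "M \<inter> ({b} \<times> \<Gamma>) = {b} \<times> (\<Union>k<N. s k ` unit_circle)"
    by (rule skew_system_of_circle_sections[OF \<Gamma>])
  then have "M \<inter> ({b} \<times> \<Gamma>) = (\<lambda>x. (b, \<Phi> x)) ` X" unfolding \<Phi>(3)[symmetric] by auto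
  moreover have "continuous_on X (\<lambda>x. (b, \<Phi> x))" by (intro continuous_intros \<Phi>(1))
  moreover have "inj_on (\<lambda>x. (b, \<Phi> x)) X" using \<Phi>(2) by (simp add: inj_on_def)
  ultimately show ?thesis unfolding occurs_as_fibre_def using system by blast
qed

lemma occurs_as_fibre_intersecting_circles:
  assumes G: "is_graph G" and C: "circle C1" "C1 \<subseteq> G" "circle C2" "C2 \<subseteq> G"
    and meet: "C1 \<inter> C2 \<noteq> {}"
  shows "occurs_as_fibre (C1 \<union> C2)"
proof -
  obtain \<zeta> \<U> where "finite \<U>" "handles C1 \<zeta> \<U>" and eq: "with_handles C1 \<zeta> \<U> = C1 \<union> C2"
    by (rule Un_circles_eq_with_handles[OF G C meet])
  obtain \<eta> where \<eta>: "continuous_on C1 \<eta>" "inj_on \<eta> C1" "\<eta> ` C1 = unit_circle"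
    by (rule circle_embedding[OF C(1)])
  obtain A N \<Phi> where "0 < N" and \<Phi>: "continuous_on (C1 \<union> C2) \<Phi>" "inj_on \<Phi> (C1 \<union> C2)"
    "\<Phi> ` (C1 \<union> C2) = pages A N"
    using embed_circle_with_handles[OF compact_circle[OF C(1)] \<eta> \<open>finite \<U>\<close> \<open>handles C1 \<zeta> \<U>\<close>]
    unfolding eq by (elim exE conjE) (rule that)
  have "is_graph (pages A N)"
    unfolding \<Phi>(3)[symmetric]
    using is_graph_Un_circles[OF G C] \<Phi>(1,2) by (rule is_graph_injective_image)
  moreover have "connected (pages A N)"
    unfolding \<Phi>(3)[symmetric]
    by (intro connected_continuous_image \<Phi>(1) connected_Un connected_circle C(1,3) meet)
  ultimately show ?thesis
    using occurs_as_fibre_of_circle_sections[OF _ _ _ \<open>0 < N\<close> \<Phi>(1,2)]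
      circle_sections_pages[OF compact_is_graph] \<Phi>(3) unfolding pages_def by blast
qed

lemma ring_Int_axis: "c \<in> {0..1} \<Longrightarrow> ring c \<inter> path_image (point3 1) = {point3 1 c}"
  by (auto simp: ring_def path_image_def point3_eq_iff)

lemma arc_point3: "arc (point3 w)"
  by (auto simp: arc_def path_def inj_on_def point3_eq_iff intro!: continuous_intros)

definition dumbbell :: "(real^3) set" where
  "dumbbell = ring 0 \<union> ring 1 \<union> path_image (point3 1)"

lemma is_graph_dumbbell: "is_graph dumbbell"
  unfolding dumbbell_def
  by (intro is_graph_joined_circles circle_ring disjoint_rings arc_point3)
     (simp_all add: ring_Int_axis pathstart_def pathfinish_def)

lemma connected_dumbbell: "connected dumbbell"
proof -
  have "connected (ring 0 \<union> path_image (point3 1) \<union> ring 1)"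
    using ring_Int_axis[of 0] ring_Int_axis[of 1]
    by (intro connected_Un connected_circle circle_ring connected_arc_image arc_point3) auto
  then show ?thesis by (simp add: dumbbell_def Un_ac)
qed

lemma circle_sections_dumbbell: "circle_sections dumbbell direction 2 (\<lambda>k w. point3 w (real k))"
proof
  show "compact dumbbell" using is_graph_dumbbell by (rule compact_is_graph)
  show "direction x \<in> unit_circle" if "x \<in> dumbbell" for x
    using that by (auto simp: dumbbell_def ring_def path_image_def sgn_eq)
  then show "continuous_on dumbbell direction" by (intro continuous_on_direction) auto
  show "point3 w (real k) \<in> dumbbell" if "k < 2" "w \<in> unit_circle" for k w
    using that unfolding dumbbell_def ring_def less_2_cases_iff by auto
qed (auto simp: sgn_eq intro!: continuous_intros)

lemma occurs_as_fibre_disjoint_circles: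
  fixes C1 C2 :: "'a::t2_space set"
  assumes C: "circle C1" "circle C2" and disjoint: "C1 \<inter> C2 = {}"
  shows "occurs_as_fibre (C1 \<union> C2)"
proof -
  obtain \<eta>1 where \<eta>1: "continuous_on C1 \<eta>1" "inj_on \<eta>1 C1" "\<eta>1 ` C1 = unit_circle"
    by (rule circle_embedding[OF C(1)])
  obtain \<eta>2 where \<eta>2: "continuous_on C2 \<eta>2" "inj_on \<eta>2 C2" "\<eta>2 ` C2 = unit_circle"
    by (rule circle_embedding[OF C(2)])
  define \<Phi> where "\<Phi> x = (if x \<in> C1 then point3 (\<eta>1 x) 0 else point3 (\<eta>2 x) 1)" for x
  have \<Phi>_C1: "\<Phi> x = point3 (\<eta>1 x) 0" if "x \<in> C1" for x using that by (simp add: \<Phi>_def)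
  have \<Phi>_C2: "\<Phi> x = point3 (\<eta>2 x) 1" if "x \<in> C2" for x using that disjoint by (auto simp: \<Phi>_def)
  have cont: "continuous_on (C1 \<union> C2) \<Phi>"
  proof (rule continuous_on_closed_Un)
    show "closed C1" "closed C2" using C compact_circle compact_imp_closed by blast+
    have "continuous_on C1 (\<lambda>x. point3 (\<eta>1 x) 0)" "continuous_on C2 (\<lambda>x. point3 (\<eta>2 x) 1)"
      by (intro continuous_intros \<eta>1(1) \<eta>2(1))+
    then show "continuous_on C1 \<Phi>" "continuous_on C2 \<Phi>"
      by (simp_all add: \<Phi>_C1 \<Phi>_C2 cong: continuous_on_cong)
  qed
  have inj: "inj_on \<Phi> (C1 \<union> C2)"
  proof -
    have "inj_on \<Phi> C1" "inj_on \<Phi> C2"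
      using \<eta>1(2) \<eta>2(2) by (simp_all add: inj_on_def \<Phi>_C1 \<Phi>_C2 point3_eq_iff)
    moreover have "\<Phi> ` C1 \<inter> \<Phi> ` C2 = {}" by (auto simp: \<Phi>_C1 \<Phi>_C2 point3_eq_iff)
    ultimately show ?thesis unfolding inj_on_Un by blast
  qed
  have "\<Phi> ` C1 = (\<lambda>w. point3 w 0) ` \<eta>1 ` C1" "\<Phi> ` C2 = (\<lambda>w. point3 w 1) ` \<eta>2 ` C2"
    unfolding image_image by (rule image_cong; simp add: \<Phi>_C1 \<Phi>_C2)+
  moreover have "{..<2::nat} = {0, 1}" by auto
  ultimately have image: "\<Phi> ` (C1 \<union> C2) = (\<Union>k<2. (\<lambda>w. point3 w (real k)) ` unit_circle)"
    by (simp add: image_Un \<eta>1(3) \<eta>2(3))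
  show ?thesis
    by (rule occurs_as_fibre_of_circle_sections[OF is_graph_dumbbell connected_dumbbell
          circle_sections_dumbbell _ cont inj image]) simp
qed

lemma fibre_of_two_circles:
  fixes C1 C2 :: "'a::t2_space set"
  assumes "occurs_as_fibre (C1 \<union> C2)" and C: "circle C1" "circle C2"
  obtains B f \<Gamma> F M b D1 D2 where "skew_system B f \<Gamma> F M b" "circle D1" "circle D2"
    "M \<inter> ({b} \<times> \<Gamma>) = D1 \<union> D2" "(M \<inter> ({b} \<times> \<Gamma>)) homeomorphic (C1 \<union> C2)"
    "C1 \<noteq> C2 \<longrightarrow> D1 \<noteq> D2" "C1 \<inter> C2 = {} \<longrightarrow> D1 \<inter> D2 = {}"
proof -
  obtain B f \<Gamma> F M b \<psi> where system: "skew_system B f \<Gamma> F M b"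
    and \<psi>: "continuous_on (C1 \<union> C2) \<psi>" "inj_on \<psi> (C1 \<union> C2)"
    and fibre: "M \<inter> ({b} \<times> \<Gamma>) = \<psi> ` (C1 \<union> C2)"
    using assms(1) unfolding occurs_as_fibre_def by (elim exE conjE) (rule that)
  show ?thesis
  proof (rule that[OF system])
    show "circle (\<psi> ` C1)" "circle (\<psi> ` C2)"
      using C continuous_on_subset[OF \<psi>(1)] inj_on_subset[OF \<psi>(2)]
      by (auto intro!: circle_injective_image)
    show "M \<inter> ({b} \<times> \<Gamma>) = \<psi> ` C1 \<union> \<psi> ` C2" unfolding fibre by (rule image_Un)
    have "(C1 \<union> C2) homeomorphic \<psi> ` (C1 \<union> C2)"
      using C \<psi> by (intro homeomorphic_compact compact_Un compact_circle) auto
    then show "(M \<inter> ({b} \<times> \<Gamma>)) homeomorphic (C1 \<union> C2)"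
      unfolding fibre by (subst homeomorphic_sym)
    show "C1 \<noteq> C2 \<longrightarrow> \<psi> ` C1 \<noteq> \<psi> ` C2" using inj_on_image_eq_iff[OF \<psi>(2), of C1 C2] by simp
    show "C1 \<inter> C2 = {} \<longrightarrow> \<psi> ` C1 \<inter> \<psi> ` C2 = {}"
      using inj_on_image_Int[OF \<psi>(2), of C1 C2] by (metis Un_upper1 Un_upper2 image_empty)
  qed
qed

theorem theoremD:
  shows "(\<forall>(G::'a::metric_space set) C1 C2.
            is_graph G \<and> C1 \<subseteq> G \<and> C2 \<subseteq> G \<and> circle C1 \<and> circle C2 \<and> C1 \<noteq> C2 \<longrightarrow>
            (\<exists>B f \<Gamma> F M b D1 D2. skew_system B f \<Gamma> F M b \<and>
               circle D1 \<and> circle D2 \<and> D1 \<noteq> D2 \<and>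
               M \<inter> ({b} \<times> \<Gamma>) = D1 \<union> D2 \<and>
               (M \<inter> ({b} \<times> \<Gamma>)) homeomorphic (C1 \<union> C2)))
       \<and> (\<exists>B f \<Gamma> F M b D1 D2. skew_system B f \<Gamma> F M b \<and>
               circle D1 \<and> circle D2 \<and> D1 \<inter> D2 = {} \<and>
               M \<inter> ({b} \<times> \<Gamma>) = D1 \<union> D2)"
    (is "(\<forall>G C1 C2. ?circles_in G C1 C2 \<longrightarrow> ?realised C1 C2) \<and> ?disjoint_realised")
proof (intro conjI allI impI)
  fix G C1 C2 :: "'a set"
  assume circles: "?circles_in G C1 C2"
  then have "occurs_as_fibre (C1 \<union> C2)"
    using occurs_as_fibre_disjoint_circles[of C1 C2]
      occurs_as_fibre_intersecting_circles[of G C1 C2]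
    by (cases "C1 \<inter> C2 = {}") simp_all
  then obtain B f \<Gamma> F M b D1 D2 where "skew_system B f \<Gamma> F M b" "circle D1" "circle D2"
    "M \<inter> ({b} \<times> \<Gamma>) = D1 \<union> D2" "(M \<inter> ({b} \<times> \<Gamma>)) homeomorphic (C1 \<union> C2)"
    "C1 \<noteq> C2 \<longrightarrow> D1 \<noteq> D2"
    using circles by (elim fibre_of_two_circles; blast intro: that)
  then show "?realised C1 C2" using circles by blast
next
  have "occurs_as_fibre (ring 0 \<union> ring 1)"
    by (intro occurs_as_fibre_disjoint_circles circle_ring disjoint_rings) simp
  then obtain B f \<Gamma> F M b D1 D2 where "skew_system B f \<Gamma> F M b" "circle D1" "circle D2"
    "M \<inter> ({b} \<times> \<Gamma>) = D1 \<union> D2" "ring 0 \<inter> ring 1 = {} \<longrightarrow> D1 \<inter> D2 = {}"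
    by (elim fibre_of_two_circles[OF _ circle_ring circle_ring]; blast intro: that)
  then show ?disjoint_realised using disjoint_rings[of 0 1] by auto
qed

end
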